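(* Let $A$ be a finite-dimensional complex algebra with fixed basis $\{a_1,\dots,a_d\}$, $d=\dim_{\mathbb{C}}A$, and let $I_A=\{\sum_i\lambda_i a_i:\lambda_i\in[0,1]\}$. (1) If $M,N$ are isomorphic finite-dimensional left $A$-modules, then $\int_{I_A}N$ and $\int_{I_A}M$ are similar (as matrices with respect to bases of $N$ and $M$). (2) For finite-dimensional left $A$-modules $M_1,\dots,M_n$, $\int_{I_A}\bigoplus_{i=1}^nM_i=\bigoplus_{i=1}^n\int_{I_A}M_i$ (block-diagonal endomorphism). (3) Let $e\in A$ be a nonzero idempotent and $\{p_1,\dots,p_r\}$ a basis of $Ae$, and write $a_ip_j=\sum_{k=1}^r\lambda_{i,j,k}p_k$ with $\lambda_{i,j,k}\in\mathbb{C}$. Then, with respect to this basis, $\int_{I_A}Ae$ is the $r\times r$ matrix whose entry in row $k$ and column $j$ is $\frac12\sum_{i=1}^{d}\lambda_{i,j,k}$. (4) Let $e\in A$ be a nonzero idempotent and $\{p_1,\dots,p_r\}$ a basis of the right $A$-module $eA$, and write $p_ja_i=\sum_{k=1}^r\mu_{i,j,k}p_k$ with $\mu_{i,j,k}\in\mathbb{C}$. Then, with respect to the dual basis $\{p_1^*,\dots,p_r^*\}$ of $D(eA)$, $\int_{I_A}D(eA)$ is the $r\times r$ matrix whose entry in row $j$ and column $k$ is $\frac12\sum_{i=1}^{d}\mu_{i,j,k}$.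
   Context: Algebras are associative and unital over $\mathbb{C}$. For a finite-dimensional left $A$-module $M$, $\rho_M:A\to\mathrm{End}_{\mathbb{C}}(M)$, $a\mapsto(m\mapsto a.m)$, is the structure homomorphism. $I_A$ is identified with $[0,1]^d$ via coordinates and equipped with the Lebesgue measure $\mu$, so $\mu(I_A)=1$. The integral of $M$ is \[ \int_{I_A}M:=\int_{I_A}\rho_M(x)\,d\mu(x)\in \mathrm{End}_{\mathbb{C}}(M) \] (vector-valued Bochner integral). $D=\mathrm{Hom}_{\mathbb{C}}(-,\mathbb{C})$; the left $A$-module structure on $D(eA)$ is $(a\cdot\varphi)(x)=\varphi(xa)$. The matrix of an endomorphism has as its $j$-th column the coordinates of the image of the $j$-th basis vector. *)

theory Defs
  imports
    "HOL-Analysis.Analysis"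
    "HOL-Library.Function_Algebras"
    "Jordan_Normal_Form.Matrix"
begin

text \<open>
  Complex vector spaces are subspaces V of an ambient type with a scalar multiplication s satisfying
  \<^locale>\<open>vector_space\<close>.  Spaces of functions (endomorphisms, functionals, families) use the
  pointwise operations; their members are normalised to be 0 outside their domain, so that equality
  of functions is equality on the domain.
\<close>

definition fun_scale :: "(complex \<Rightarrow> 'v \<Rightarrow> 'v) \<Rightarrow> complex \<Rightarrow> ('i \<Rightarrow> 'v) \<Rightarrow> 'i \<Rightarrow> 'v" where
  "fun_scale s c f = (\<lambda>x. s c (f x))"

definition indexed_basis ::
    "(complex \<Rightarrow> 'v \<Rightarrow> 'v) \<Rightarrow> 'v set \<Rightarrow> nat \<Rightarrow> (nat \<Rightarrow> 'v::ab_group_add) \<Rightarrow> bool" where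
  "indexed_basis s V r p \<longleftrightarrow>
     inj_on p {..<r} \<and> \<not> module.dependent s (p ` {..<r}) \<and> module.span s (p ` {..<r}) = V"

definition matrix_of ::
    "(complex \<Rightarrow> 'v \<Rightarrow> 'v) \<Rightarrow> nat \<Rightarrow> (nat \<Rightarrow> 'v::ab_group_add) \<Rightarrow> ('v \<Rightarrow> 'v) \<Rightarrow> complex mat" where
  "matrix_of s r p T =
     Matrix.mat r r (\<lambda>(k, j). module.representation s (p ` {..<r}) (T (p j)) (p k))"

definition linear_maps ::
    "(complex \<Rightarrow> 'v \<Rightarrow> 'v) \<Rightarrow> 'v::ab_group_add set \<Rightarrow> (complex \<Rightarrow> 'w \<Rightarrow> 'w) \<Rightarrow> 'w::ab_group_add set
      \<Rightarrow> ('v \<Rightarrow> 'w) set" where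
  "linear_maps s V t W =
     {f. (\<forall>x\<in>V. f x \<in> W) \<and> (\<forall>x\<in>V. \<forall>y\<in>V. f (x + y) = f x + f y) \<and>
         (\<forall>c. \<forall>x\<in>V. f (s c x) = t c (f x)) \<and> (\<forall>x. x \<notin> V \<longrightarrow> f x = 0)}"

abbreviation endos :: "(complex \<Rightarrow> 'v \<Rightarrow> 'v) \<Rightarrow> 'v::ab_group_add set \<Rightarrow> ('v \<Rightarrow> 'v) set" where
  "endos s V \<equiv> linear_maps s V s V"


section \<open>Bochner integral in a normed subspace\<close>

text \<open>
  The integral of the library takes values in a type of class \<^class>\<open>real_normed_vector\<close>, whereas
  the spaces of endomorphisms below are carrier sets depending on terms.  The following repeats the
  construction of the library (approximation in the mean by simple functions) relative to a carrier
  set V and a norm on V.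
\<close>

definition norm_on ::
    "(complex \<Rightarrow> 'v \<Rightarrow> 'v) \<Rightarrow> 'v::ab_group_add set \<Rightarrow> ('v \<Rightarrow> real) \<Rightarrow> bool" where
  "norm_on s V nrm \<longleftrightarrow>
     (\<forall>x\<in>V. 0 \<le> nrm x \<and> (nrm x = 0 \<longleftrightarrow> x = 0)) \<and>
     (\<forall>x\<in>V. \<forall>y\<in>V. nrm (x + y) \<le> nrm x + nrm y) \<and>
     (\<forall>c. \<forall>x\<in>V. nrm (s c x) = cmod c * nrm x)"

definition simple_map :: "'v::ab_group_add set \<Rightarrow> 'x measure \<Rightarrow> ('x \<Rightarrow> 'v) \<Rightarrow> bool" where
  "simple_map V \<mu> t \<longleftrightarrow>
     simple_function \<mu> t \<and> t ` space \<mu> \<subseteq> V \<and> emeasure \<mu> {x\<in>space \<mu>. t x \<noteq> 0} \<noteq> \<infinity>"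

definition simple_map_integral ::
    "(complex \<Rightarrow> 'v \<Rightarrow> 'v) \<Rightarrow> 'x measure \<Rightarrow> ('x \<Rightarrow> 'v::ab_group_add) \<Rightarrow> 'v" where
  "simple_map_integral s \<mu> t =
     (\<Sum>y\<in>t ` space \<mu>. s (complex_of_real (measure \<mu> {x\<in>space \<mu>. t x = y})) y)"

definition strongly_measurable_on ::
    "'v::ab_group_add set \<Rightarrow> ('v \<Rightarrow> real) \<Rightarrow> 'x measure \<Rightarrow> ('x \<Rightarrow> 'v) \<Rightarrow> bool" where
  "strongly_measurable_on V nrm \<mu> f \<longleftrightarrow>
     (\<exists>t. (\<forall>i::nat. simple_map V \<mu> (t i)) \<and>
          (AE x in \<mu>. (\<lambda>i. nrm (f x - t i x)) \<longlonglongrightarrow> 0))"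

definition has_bochner_integral_on ::
    "(complex \<Rightarrow> 'v \<Rightarrow> 'v) \<Rightarrow> 'v::ab_group_add set \<Rightarrow> ('v \<Rightarrow> real) \<Rightarrow> 'x measure \<Rightarrow> ('x \<Rightarrow> 'v) \<Rightarrow> 'v
      \<Rightarrow> bool" where
  "has_bochner_integral_on s V nrm \<mu> f v \<longleftrightarrow>
     f ` space \<mu> \<subseteq> V \<and> v \<in> V \<and> strongly_measurable_on V nrm \<mu> f \<and>
     (\<exists>t. (\<forall>i::nat. simple_map V \<mu> (t i)) \<and>
          (\<lambda>i. \<integral>\<^sup>+x. ennreal (nrm (f x - t i x)) \<partial>\<mu>) \<longlonglongrightarrow> 0 \<and>
          (\<lambda>i. nrm (simple_map_integral s \<mu> (t i) - v)) \<longlonglongrightarrow> 0)"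


section \<open>Algebras and modules\<close>

text \<open>
  The sort \<open>{ring, monoid_mult}\<close> is used instead of \<^class>\<open>ring_1\<close> because the latter
  excludes the zero algebra.
\<close>

locale complex_algebra = vector_space sA
  for sA :: "complex \<Rightarrow> 'a::{ring, monoid_mult} \<Rightarrow> 'a" +
  assumes scale_mult_left: "sA c x * y = sA c (x * y)"
    and scale_mult_right: "x * sA c y = sA c (x * y)"

locale fd_left_module =
  A: complex_algebra sA + V: vector_space sM
  for sA :: "complex \<Rightarrow> 'a::{ring, monoid_mult} \<Rightarrow> 'a"
    and sM :: "complex \<Rightarrow> 'm::ab_group_add \<Rightarrow> 'm" +
  fixes M :: "'m set" and act :: "'a \<Rightarrow> 'm \<Rightarrow> 'm"
  assumes subspace: "V.subspace M"
    and finite_dim: "\<exists>B. finite B \<and> V.span B = M"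
    and act_closed: "m \<in> M \<Longrightarrow> act x m \<in> M"
    and act_add_left: "m \<in> M \<Longrightarrow> act (x + y) m = act x m + act y m"
    and act_add_right: "m \<in> M \<Longrightarrow> m' \<in> M \<Longrightarrow> act x (m + m') = act x m + act x m'"
    and act_scale_left: "m \<in> M \<Longrightarrow> act (sA c x) m = sM c (act x m)"
    and act_scale_right: "m \<in> M \<Longrightarrow> act x (sM c m) = sM c (act x m)"
    and act_mult: "m \<in> M \<Longrightarrow> act (x * y) m = act x (act y m)"
    and act_one: "m \<in> M \<Longrightarrow> act 1 m = m"

definition isomorphic_modules ::
    "(complex \<Rightarrow> 'm \<Rightarrow> 'm) \<Rightarrow> 'm::ab_group_add set \<Rightarrow> ('a \<Rightarrow> 'm \<Rightarrow> 'm) \<Rightarrow>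
     (complex \<Rightarrow> 'n \<Rightarrow> 'n) \<Rightarrow> 'n::ab_group_add set \<Rightarrow> ('a \<Rightarrow> 'n \<Rightarrow> 'n) \<Rightarrow> bool" where
  "isomorphic_modules sM M actM sN N actN \<longleftrightarrow>
     (\<exists>h \<in> linear_maps sM M sN N. bij_betw h M N \<and>
        (\<forall>x. \<forall>m\<in>M. h (actM x m) = actN x (h m)))"

definition structure_hom ::
    "'m::ab_group_add set \<Rightarrow> ('a \<Rightarrow> 'm \<Rightarrow> 'm) \<Rightarrow> 'a \<Rightarrow> 'm \<Rightarrow> 'm" where
  "structure_hom M act x = (\<lambda>m. if m \<in> M then act x m else 0)"

text \<open>External direct sum of n modules lying in a common ambient space.\<close>

definition dsum_carrier :: "nat \<Rightarrow> (nat \<Rightarrow> 'm::ab_group_add set) \<Rightarrow> (nat \<Rightarrow> 'm) set" where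
  "dsum_carrier n M = {f. (\<forall>i<n. f i \<in> M i) \<and> (\<forall>i\<ge>n. f i = 0)}"

definition dsum_act ::
    "nat \<Rightarrow> (nat \<Rightarrow> 'a \<Rightarrow> 'm \<Rightarrow> 'm) \<Rightarrow> 'a \<Rightarrow> (nat \<Rightarrow> 'm::ab_group_add) \<Rightarrow> nat \<Rightarrow> 'm" where
  "dsum_act n act x f = (\<lambda>i. if i < n then act i x (f i) else 0)"

definition dsum_endo ::
    "nat \<Rightarrow> (nat \<Rightarrow> 'm::ab_group_add set) \<Rightarrow> (nat \<Rightarrow> 'm \<Rightarrow> 'm) \<Rightarrow> (nat \<Rightarrow> 'm) \<Rightarrow> nat \<Rightarrow> 'm" where
  "dsum_endo n M T f =
     (if f \<in> dsum_carrier n M then (\<lambda>i. if i < n then T i (f i) else 0) else 0)"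

definition left_ideal_of :: "'a::times \<Rightarrow> 'a set" where
  "left_ideal_of e = {x * e |x. True}"

definition right_ideal_of :: "'a::times \<Rightarrow> 'a set" where
  "right_ideal_of e = {e * x |x. True}"

definition dual_space ::
    "(complex \<Rightarrow> 'v \<Rightarrow> 'v) \<Rightarrow> 'v::ab_group_add set \<Rightarrow> ('v \<Rightarrow> complex) set" where
  "dual_space s V = linear_maps s V (*) UNIV"

definition dual_act :: "'a::times set \<Rightarrow> 'a \<Rightarrow> ('a \<Rightarrow> complex) \<Rightarrow> 'a \<Rightarrow> complex" where
  "dual_act V a \<phi> = (\<lambda>x. if x \<in> V then \<phi> (x * a) else 0)"

definition dual_basis ::
    "(complex \<Rightarrow> 'v \<Rightarrow> 'v) \<Rightarrow> nat \<Rightarrow> (nat \<Rightarrow> 'v::ab_group_add) \<Rightarrow> nat \<Rightarrow> 'v \<Rightarrow> complex" where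
  "dual_basis s r p j = (\<lambda>x. module.representation s (p ` {..<r}) x (p j))"


section \<open>The integral of a module\<close>

definition lin_comb ::
    "(complex \<Rightarrow> 'a \<Rightarrow> 'a) \<Rightarrow> nat \<Rightarrow> (nat \<Rightarrow> 'a::ab_group_add) \<Rightarrow> (nat \<Rightarrow> real) \<Rightarrow> 'a" where
  "lin_comb s d a l = (\<Sum>i<d. s (complex_of_real (l i)) (a i))"

definition lebesgue_cube :: "nat \<Rightarrow> (nat \<Rightarrow> real) measure" where
  "lebesgue_cube d = completion (\<Pi>\<^sub>M i\<in>{..<d}. restrict_space lborel {0..1})"

text \<open>The cube spanned by a, with Lebesgue measure carried over along the coordinates.\<close>

definition basis_cube_measure ::
    "(complex \<Rightarrow> 'a \<Rightarrow> 'a) \<Rightarrow> nat \<Rightarrow> (nat \<Rightarrow> 'a::ab_group_add) \<Rightarrow> 'a measure" where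
  "basis_cube_measure s d a = embed_measure (lebesgue_cube d) (lin_comb s d a)"

lemma space_basis_cube_measure:
  "space (basis_cube_measure s d a) =
     {\<Sum>i<d. s (complex_of_real (l i)) (a i) |l. \<forall>i<d. l i \<in> {0..1}}" (is "?L = ?R")
proof
  show "?L \<subseteq> ?R"
    by (auto simp: basis_cube_measure_def space_embed_measure lebesgue_cube_def lin_comb_def
        space_PiM space_restrict_space PiE_iff)
  show "?R \<subseteq> ?L"
  proof safe
    fix l :: "nat \<Rightarrow> real" assume l: "\<forall>i<d. l i \<in> {0..1}"
    have "(\<Sum>i<d. s (complex_of_real (l i)) (a i)) = lin_comb s d a (restrict l {..<d})"
      by (simp add: lin_comb_def)
    moreover have "restrict l {..<d} \<in> space (lebesgue_cube d)"
      using l by (auto simp: lebesgue_cube_def space_PiM space_restrict_space)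
    ultimately show "(\<Sum>i<d. s (complex_of_real (l i)) (a i)) \<in> ?L"
      by (auto simp: basis_cube_measure_def space_embed_measure)
  qed
qed

lemma emeasure_lebesgue_cube: "emeasure (lebesgue_cube d) (space (lebesgue_cube d)) = 1"
proof -
  have one: "emeasure (restrict_space lborel {0..1::real}) {0..1} = 1"
    by (simp add: emeasure_restrict_space)
  interpret finite_measure "restrict_space lborel {0..1::real}"
    by (rule finite_measureI) (simp add: space_restrict_space one)
  interpret product_sigma_finite "\<lambda>_::nat. restrict_space lborel {0..1::real}"
    by (simp add: product_sigma_finite_def sigma_finite_measure_axioms)
  have "emeasure (\<Pi>\<^sub>M i\<in>{..<d}. restrict_space lborel {0..1::real})
      (space (\<Pi>\<^sub>M i\<in>{..<d}. restrict_space lborel {0..1::real})) = 1"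
    unfolding space_PiM by (subst emeasure_PiM) (auto simp: space_restrict_space sets_restrict_space_iff one)
  then show ?thesis
    by (simp add: lebesgue_cube_def)
qed

text \<open>
  The endomorphism space of a finite-dimensional module has one vector space topology, given by
  each of its norms; requiring the integral for all of them avoids singling one out.
\<close>

definition module_integral ::
    "(complex \<Rightarrow> 'a \<Rightarrow> 'a) \<Rightarrow> nat \<Rightarrow> (nat \<Rightarrow> 'a::ab_group_add) \<Rightarrow>
     (complex \<Rightarrow> 'm \<Rightarrow> 'm) \<Rightarrow> 'm::ab_group_add set \<Rightarrow> ('a \<Rightarrow> 'm \<Rightarrow> 'm) \<Rightarrow> 'm \<Rightarrow> 'm" where
  "module_integral sA d a sM M act =
     (THE T. T \<in> endos sM M \<and>
        (\<forall>nrm. norm_on (fun_scale sM) (endos sM M) nrm \<longrightarrow>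
           has_bochner_integral_on (fun_scale sM) (endos sM M) nrm
             (basis_cube_measure sA d a) (structure_hom M act) T))"

end

theory Submission
  imports Defs "HOL-Probability.Infinite_Product_Measure"
begin

text \<open>
  All four parts rest on one formula.  The structure homomorphism \<open>\<rho>\<close> of a module is linear, so at a
  point of the cube with coordinates \<open>l\<close> its value is \<open>\<Sum>i. l i \<rho>(a i)\<close>.  Integration over the cube acts
  on the coordinates only, and each of them has mean \<open>1 / 2\<close>.  Hence the integral of the module is
  \<open>\<rho>(h)\<close>, where \<open>h = \<Sum>i. (1 / 2) a i\<close> is the barycentre of the cube (\<open>module_integral_eq\<close>).  After that,
  an isomorphism intertwines the two actions of \<open>h\<close>; \<open>h\<close> acts on a direct sum componentwise; and the
  matrices for \<open>A e\<close> and the dual of \<open>e A\<close> are read off from the products of \<open>h\<close> with the basis elements.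

  The analytic work lies in justifying the formula for the integral relative to a carrier set and an
  arbitrary norm.  It suffices to have simple maps that converge uniformly and whose integrals
  converge (\<open>has_bochner_integral_on_uniform_limit_iff\<close>): they show that the limit is the integral and
  also that no other value is.  Such simple maps are obtained by rounding the coordinates to a grid
  (\<open>has_bochner_integral_on_combination_iff\<close>).  Since \<open>module_integral\<close> is a definite description, a norm on the
  endomorphism space has to be exhibited for uniqueness (\<open>exists_norm_on_endos\<close>).
\<close>

section \<open>Bochner integrals of uniform limits of simple maps\<close>

text \<open>
  A simple map \<open>t\<close> that factors as \<open>F \<circ> u\<close> through a finer simple function \<open>u\<close> can be integrated
  over the level sets of \<open>u\<close>, although \<open>F\<close> may merge several of them.  Taking for \<open>u\<close> a pair of
  simple maps compares two integrals over a common partition; taking for \<open>u\<close> grid coordinates makes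
  an integral of a vector-valued map computable coordinate by coordinate.
\<close>

lemma simple_map_integral_comp:
  assumes "finite_measure \<mu>" and u: "simple_function \<mu> u"
    and t: "\<And>x. x \<in> space \<mu> \<Longrightarrow> t x = F (u x)"
    and s: "vector_space s"
  shows "simple_map_integral s \<mu> t =
    (\<Sum>z\<in>u ` space \<mu>. s (complex_of_real (measure \<mu> {x\<in>space \<mu>. u x = z})) (F z))"
proof -
  interpret finite_measure \<mu> by fact
  interpret vector_space s by fact
  let ?U = "u ` space \<mu>"
  have fin: "finite ?U" using u by (simp add: simple_function_def)
  have meas: "{x\<in>space \<mu>. u x = z} \<in> sets \<mu>" for z
    using simple_functionD(2)[OF u, of "{z}"] by (simp add: vimage_def Int_def conj_commute)
  have img: "t ` space \<mu> = F ` ?U" using t by (auto simp: image_iff)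
  have "measure \<mu> {x\<in>space \<mu>. t x = y} =
      (\<Sum>z\<in>{z\<in>?U. F z = y}. measure \<mu> {x\<in>space \<mu>. u x = z})" for y
  proof -
    have "{x\<in>space \<mu>. t x = y} = (\<Union>z\<in>{z\<in>?U. F z = y}. {x\<in>space \<mu>. u x = z})"
      using t by auto
    then show ?thesis
      using fin meas by (simp, subst finite_measure_finite_Union) (auto simp: disjoint_family_on_def)
  qed
  then have "simple_map_integral s \<mu> t = (\<Sum>y\<in>F ` ?U. \<Sum>z\<in>{z\<in>?U. F z = y}.
      s (complex_of_real (measure \<mu> {x\<in>space \<mu>. u x = z})) (F z))"
    unfolding simple_map_integral_def img
    by (auto simp: scale_sum_left intro!: sum.cong)
  also have "\<dots> = (\<Sum>z\<in>?U. s (complex_of_real (measure \<mu> {x\<in>space \<mu>. u x = z})) (F z))"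
    using fin by (intro sum.group) auto
  finally show ?thesis .
qed

lemma integral_comp_simple_function:
  fixes G :: "'b \<Rightarrow> real"
  assumes "finite_measure \<mu>" and u: "simple_function \<mu> u"
  shows "integrable \<mu> (\<lambda>x. G (u x))"
    and "(\<integral>x. G (u x) \<partial>\<mu>) = (\<Sum>z\<in>u ` space \<mu>. measure \<mu> {x\<in>space \<mu>. u x = z} * G z)"
proof -
  interpret finite_measure \<mu> by fact
  have fin: "finite (u ` space \<mu>)" using u by (simp add: simple_function_def)
  have meas: "{x\<in>space \<mu>. u x = z} \<in> sets \<mu>" for z
    using simple_functionD(2)[OF u, of "{z}"] by (simp add: vimage_def Int_def conj_commute)
  have eq: "G (u x) = (\<Sum>z\<in>u ` space \<mu>. indicator {x\<in>space \<mu>. u x = z} x * G z)"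
    if "x \<in> space \<mu>" for x
    using that fin by (subst sum.remove[of _ "u x"]) (auto simp: indicator_def intro!: sum.neutral)
  have int: "integrable \<mu> (\<lambda>x. indicator {x\<in>space \<mu>. u x = z} x * G z)" for z
    using meas by (intro integrable_mult_left integrable_real_indicator) (auto simp: emeasure_eq_measure)
  show "integrable \<mu> (\<lambda>x. G (u x))"
    using int eq by (subst Bochner_Integration.integrable_cong[OF refl eq]) auto
  have "(\<integral>x. G (u x) \<partial>\<mu>) = (\<integral>x. (\<Sum>z\<in>u ` space \<mu>. indicator {x\<in>space \<mu>. u x = z} x * G z) \<partial>\<mu>)"
    by (intro Bochner_Integration.integral_cong refl eq)
  also have "\<dots> = (\<Sum>z\<in>u ` space \<mu>. measure \<mu> {x\<in>space \<mu>. u x = z} * G z)"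
    using meas by (subst Bochner_Integration.integral_sum[OF int]) auto
  finally show "(\<integral>x. G (u x) \<partial>\<mu>) = (\<Sum>z\<in>u ` space \<mu>. measure \<mu> {x\<in>space \<mu>. u x = z} * G z)" .
qed

locale normed_subspace = vector_space s
  for s :: "complex \<Rightarrow> 'v \<Rightarrow> 'v::ab_group_add" +
  fixes V :: "'v set" and nrm :: "'v \<Rightarrow> real"
  assumes subspace_V: "subspace V" and norm_on_V: "norm_on s V nrm"
begin

lemma nrm_nonneg: "x \<in> V \<Longrightarrow> 0 \<le> nrm x"
  and nrm_eq_0: "x \<in> V \<Longrightarrow> nrm x = 0 \<longleftrightarrow> x = 0"
  and nrm_triangle: "x \<in> V \<Longrightarrow> y \<in> V \<Longrightarrow> nrm (x + y) \<le> nrm x + nrm y"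
  and nrm_scale: "x \<in> V \<Longrightarrow> nrm (s c x) = cmod c * nrm x"
  using norm_on_V by (auto simp: norm_on_def)

lemma nrm_minus_commute:
  assumes "x \<in> V" "y \<in> V" shows "nrm (x - y) = nrm (y - x)"
  using nrm_scale[of "y - x" "-1"] assms subspace_V by (simp add: subspace_diff)

lemma nrm_triangle_diff:
  assumes "x \<in> V" "y \<in> V" "z \<in> V" shows "nrm (x - z) \<le> nrm (x - y) + nrm (y - z)"
  using nrm_triangle[of "x - y" "y - z"] assms subspace_V by (simp add: subspace_diff)

lemma nrm_sum_scale_le:
  assumes "\<And>i. i \<in> I \<Longrightarrow> v i \<in> V"
  shows "nrm (\<Sum>i\<in>I. s (c i) (v i)) \<le> (\<Sum>i\<in>I. cmod (c i) * nrm (v i))"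
  using assms
proof (induction I rule: infinite_finite_induct)
  case (insert i I)
  have "nrm (s (c i) (v i) + (\<Sum>i\<in>I. s (c i) (v i)))
      \<le> nrm (s (c i) (v i)) + nrm (\<Sum>i\<in>I. s (c i) (v i))"
    using insert subspace_V by (intro nrm_triangle subspace_scale subspace_sum) auto
  with insert show ?case by (auto simp: nrm_scale)
qed (use nrm_eq_0[of 0] subspace_V in \<open>auto simp: subspace_0\<close>)

lemma simple_map_integral_in:
  assumes "simple_map V \<mu> t" shows "simple_map_integral s \<mu> t \<in> V"
  using assms subspace_V unfolding simple_map_integral_def simple_map_def
  by (intro subspace_sum subspace_scale) auto

text \<open>
  The triangle inequality for integrals of simple maps, obtained from the finite triangle inequality
  on the common partition given by the pair of maps.
\<close>

lemma nrm_simple_map_integral_diff_le: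
  assumes "finite_measure \<mu>" and t: "simple_map V \<mu> t" and t': "simple_map V \<mu> t'"
  shows "ennreal (nrm (simple_map_integral s \<mu> t - simple_map_integral s \<mu> t'))
    \<le> (\<integral>\<^sup>+x. ennreal (nrm (t x - t' x)) \<partial>\<mu>)"
proof -
  interpret finite_measure \<mu> by fact
  define u where "u = (\<lambda>x. (t x, t' x))"
  have u: "simple_function \<mu> u"
    using t t' unfolding u_def simple_map_def by (intro simple_function_Pair) auto
  let ?U = "u ` space \<mu>" and ?m = "\<lambda>z. measure \<mu> {x\<in>space \<mu>. u x = z}"
  have V: "fst z - snd z \<in> V" if "z \<in> ?U" for z
    using that t t' subspace_V unfolding u_def simple_map_def by (auto intro!: subspace_diff)
  have "simple_map_integral s \<mu> t = (\<Sum>z\<in>?U. s (?m z) (fst z))"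
    using u by (intro simple_map_integral_comp) (simp_all add: u_def finite_measure_axioms vector_space_axioms)
  moreover have "simple_map_integral s \<mu> t' = (\<Sum>z\<in>?U. s (?m z) (snd z))"
    using u by (intro simple_map_integral_comp) (simp_all add: u_def finite_measure_axioms vector_space_axioms)
  ultimately have "simple_map_integral s \<mu> t - simple_map_integral s \<mu> t' =
      (\<Sum>z\<in>?U. s (?m z) (fst z - snd z))"
    by (simp add: sum_subtractf scale_right_diff_distrib)
  then have "nrm (simple_map_integral s \<mu> t - simple_map_integral s \<mu> t')
      \<le> (\<Sum>z\<in>?U. cmod (complex_of_real (?m z)) * nrm (fst z - snd z))"
    using nrm_sum_scale_le[of ?U "\<lambda>z. fst z - snd z" "\<lambda>z. complex_of_real (?m z)", OF V] by simp
  then have "ennreal (nrm (simple_map_integral s \<mu> t - simple_map_integral s \<mu> t'))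
      \<le> ennreal (\<Sum>z\<in>?U. nrm (fst z - snd z) * ?m z)"
    by (intro ennreal_leI) (simp add: mult.commute)
  also have "\<dots> = (\<Sum>z\<in>?U. ennreal (nrm (fst z - snd z)) * emeasure \<mu> {x\<in>space \<mu>. u x = z})"
    using nrm_nonneg[OF V] by (subst sum_ennreal[symmetric]) (auto simp: emeasure_eq_measure ennreal_mult)
  also have "\<dots> = integral\<^sup>S \<mu> (\<lambda>x. ennreal (nrm (t x - t' x)))"
    using u by (intro simple_function_partition[symmetric])
      (auto simp: u_def intro: simple_function_compose1[OF u, of "\<lambda>z. ennreal (nrm (fst z - snd z))", unfolded u_def fst_conv snd_conv])
  also have "\<dots> = (\<integral>\<^sup>+x. ennreal (nrm (t x - t' x)) \<partial>\<mu>)"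
    using simple_function_compose1[OF u, of "\<lambda>z. ennreal (nrm (fst z - snd z))"]
    by (intro nn_integral_eq_simple_integral[symmetric]) (simp add: u_def)
  finally show ?thesis .
qed

text \<open>
  One uniform approximation by simple maps decides the integral, in both directions.  Existence is
  immediate.  For uniqueness, let \<open>t\<close> be the approximation in the mean that witnesses another value
  \<open>v\<close>; then the integrals of \<open>t n\<close> and \<open>T n\<close> differ by at most the mean distance of \<open>t n\<close> and
  \<open>T n\<close>, which tends to 0 because both are close to \<open>f\<close>.
\<close>

lemma has_bochner_integral_on_uniform_limit_iff:
  assumes "finite_measure \<mu>"
    and f: "f ` space \<mu> \<subseteq> V" and w: "w \<in> V"
    and T: "\<And>n. simple_map V \<mu> (T n)"
    and T_close: "\<And>n x. x \<in> space \<mu> \<Longrightarrow> nrm (f x - T n x) \<le> e n" and e: "e \<longlonglongrightarrow> 0"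
    and T_int: "(\<lambda>n. nrm (simple_map_integral s \<mu> (T n) - w)) \<longlonglongrightarrow> 0"
  shows "has_bochner_integral_on s V nrm \<mu> f v \<longleftrightarrow> v = w"
proof
  interpret finite_measure \<mu> by fact
  have TV: "T n x \<in> V" if "x \<in> space \<mu>" for n x using T[of n] that by (auto simp: simple_map_def)
  have fV: "f x \<in> V" if "x \<in> space \<mu>" for x using f that by auto
  have diff: "f x - T n x \<in> V" if "x \<in> space \<mu>" for n x
    using that TV fV subspace_V by (simp add: subspace_diff)
  have lim_const: "(\<lambda>n. ennreal (e n) * emeasure \<mu> (space \<mu>)) \<longlonglongrightarrow> 0"
  proof -
    have "(\<lambda>n. ennreal (e n * measure \<mu> (space \<mu>))) \<longlonglongrightarrow> ennreal (0 * measure \<mu> (space \<mu>))"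
      by (intro tendsto_ennrealI tendsto_mult e tendsto_const)
    then show ?thesis by (simp add: emeasure_eq_measure ennreal_mult'')
  qed
  show "has_bochner_integral_on s V nrm \<mu> f v" if "v = w"
  proof -
    have "AE x in \<mu>. (\<lambda>i. nrm (f x - T i x)) \<longlonglongrightarrow> 0"
    proof (rule AE_I2)
      fix x assume "x \<in> space \<mu>"
      then show "(\<lambda>i. nrm (f x - T i x)) \<longlonglongrightarrow> 0"
        using diff T_close
        by (intro tendsto_sandwich[OF _ _ tendsto_const e] always_eventually allI) (auto intro: nrm_nonneg)
    qed
    moreover have "(\<lambda>i. \<integral>\<^sup>+x. ennreal (nrm (f x - T i x)) \<partial>\<mu>) \<longlonglongrightarrow> 0"
    proof (rule tendsto_sandwich[OF _ _ tendsto_const lim_const])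
      show "\<forall>\<^sub>F n in sequentially. (\<integral>\<^sup>+x. ennreal (nrm (f x - T n x)) \<partial>\<mu>) \<le> ennreal (e n) * emeasure \<mu> (space \<mu>)"
      proof (intro always_eventually allI)
        fix n
        have "(\<integral>\<^sup>+x. ennreal (nrm (f x - T n x)) \<partial>\<mu>) \<le> (\<integral>\<^sup>+x. ennreal (e n) \<partial>\<mu>)"
          using T_close by (intro nn_integral_mono ennreal_leI) auto
        then show "(\<integral>\<^sup>+x. ennreal (nrm (f x - T n x)) \<partial>\<mu>) \<le> ennreal (e n) * emeasure \<mu> (space \<mu>)"
          by simp
      qed
    qed simp
    ultimately show ?thesis
      using that f w T T_int unfolding has_bochner_integral_on_def strongly_measurable_on_def by blast
  qed
  assume "has_bochner_integral_on s V nrm \<mu> f v"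
  then obtain t where v: "v \<in> V" and t: "\<And>i. simple_map V \<mu> (t i)"
    and t_lim: "(\<lambda>i. \<integral>\<^sup>+x. ennreal (nrm (f x - t i x)) \<partial>\<mu>) \<longlonglongrightarrow> 0"
    and t_int: "(\<lambda>i. nrm (simple_map_integral s \<mu> (t i) - v)) \<longlonglongrightarrow> 0"
    unfolding has_bochner_integral_on_def by blast
  have tV: "t n x \<in> V" if "x \<in> space \<mu>" for n x using t[of n] that by (auto simp: simple_map_def)
  let ?I = "simple_map_integral s \<mu>"
  let ?b = "\<lambda>n. ennreal (nrm (?I (t n) - v)) + ((\<integral>\<^sup>+x. ennreal (nrm (f x - t n x)) \<partial>\<mu>) +
      ennreal (e n) * emeasure \<mu> (space \<mu>)) + ennreal (nrm (?I (T n) - w))"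
  have bound: "ennreal (nrm (v - w)) \<le> ?b n" for n
  proof -
    let ?h = "\<lambda>x. ennreal (nrm (t n x - T n x))"
    have h_meas: "?h \<in> borel_measurable \<mu>"
    proof -
      have "simple_function \<mu> (\<lambda>x. (t n x, T n x))"
        using t T unfolding simple_map_def by (intro simple_function_Pair) auto
      from simple_function_compose1[OF this, of "\<lambda>z. ennreal (nrm (fst z - snd z))"] show ?thesis
        by (auto intro: borel_measurable_simple_function)
    qed
    \<comment> \<open>The integrand \<open>nrm (f x - t n x)\<close> need not be measurable; the constant is therefore moved
      to the other side, where the integrand is a simple function.\<close>
    have "(\<integral>\<^sup>+x. ?h x \<partial>\<mu>) \<le> (\<integral>\<^sup>+x. (?h x - ennreal (e n)) + ennreal (e n) \<partial>\<mu>)"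
      by (intro nn_integral_mono) (metis add.commute ennreal_minus_le_iff order_refl)
    also have "\<dots> = (\<integral>\<^sup>+x. ?h x - ennreal (e n) \<partial>\<mu>) + ennreal (e n) * emeasure \<mu> (space \<mu>)"
      using h_meas by (subst nn_integral_add) auto
    also have "(\<integral>\<^sup>+x. ?h x - ennreal (e n) \<partial>\<mu>) \<le> (\<integral>\<^sup>+x. ennreal (nrm (f x - t n x)) \<partial>\<mu>)"
    proof (intro nn_integral_mono)
      fix x assume x: "x \<in> space \<mu>"
      have "nrm (t n x - T n x) \<le> nrm (f x - t n x) + e n"
        using nrm_triangle_diff[OF tV[OF x] fV[OF x] TV[OF x]] T_close[OF x, of n]
        by (metis add_left_mono fV nrm_minus_commute order_trans tV x)
      moreover have "0 \<le> e n" using T_close[OF x, of n] nrm_nonneg[OF diff[OF x, of n]] by linarith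
      moreover have "0 \<le> nrm (f x - t n x)"
        using fV tV x subspace_V by (simp add: nrm_nonneg subspace_diff)
      ultimately have "?h x \<le> ennreal (e n) + ennreal (nrm (f x - t n x))"
        by (metis add.commute ennreal_leI ennreal_plus)
      then show "?h x - ennreal (e n) \<le> ennreal (nrm (f x - t n x))"
        by (simp add: ennreal_minus_le_iff)
    qed
    finally have "ennreal (nrm (?I (t n) - ?I (T n)))
        \<le> (\<integral>\<^sup>+x. ennreal (nrm (f x - t n x)) \<partial>\<mu>) + ennreal (e n) * emeasure \<mu> (space \<mu>)"
      using nrm_simple_map_integral_diff_le[OF \<open>finite_measure \<mu>\<close> t T] order_trans
      by (meson add_right_mono)
    moreover have "nrm (v - w) \<le> nrm (?I (t n) - v) + nrm (?I (t n) - ?I (T n)) + nrm (?I (T n) - w)"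
      using nrm_triangle_diff[of v "?I (t n)" w] nrm_triangle_diff[of "?I (t n)" "?I (T n)" w]
        nrm_minus_commute[of v "?I (t n)"] v w simple_map_integral_in[OF t] simple_map_integral_in[OF T]
      by (metis (no_types, opaque_lifting) add.assoc add_left_mono order_trans)
    then have "ennreal (nrm (v - w)) \<le> ennreal (nrm (?I (t n) - v)) + ennreal (nrm (?I (t n) - ?I (T n)))
        + ennreal (nrm (?I (T n) - w))"
      using v w simple_map_integral_in[OF t] simple_map_integral_in[OF T] subspace_V
      by (simp add: ennreal_plus[symmetric] nrm_nonneg subspace_diff ennreal_leI del: ennreal_plus)
    ultimately show ?thesis by (meson add_left_mono add_right_mono order_trans)
  qed
  have "?b \<longlonglongrightarrow> ennreal 0 + (0 + 0) + ennreal 0"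
    by (intro tendsto_add tendsto_ennrealI t_int t_lim lim_const T_int)
  then have "ennreal (nrm (v - w)) \<le> 0"
    using bound by (intro tendsto_lowerbound[where F=sequentially]) auto
  then have "nrm (v - w) = 0"
    using nrm_nonneg[of "v - w"] v w subspace_V by (simp add: subspace_diff ennreal_eq_0_iff)
  then show "v = w" using nrm_eq_0[of "v - w"] v w subspace_V by (simp add: subspace_diff)
qed

text \<open>
  A combination of fixed vectors with bounded measurable coefficients is integrated by integrating
  the coefficients.  Rounding every coefficient down to a multiple of \<open>1 / Suc n\<close> gives the simple
  maps needed for \<open>has_bochner_integral_on_uniform_limit_iff\<close>: they take finitely many values, and
  each coefficient is off by at most \<open>1 / Suc n\<close> everywhere, so that its integral is off by at most
  \<open>1 / Suc n\<close> times the total mass.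
\<close>

lemma has_bochner_integral_on_combination_iff:
  fixes d :: nat and L :: "nat \<Rightarrow> 'x \<Rightarrow> real"
  assumes "finite_measure \<mu>"
    and L_meas: "\<And>i. i < d \<Longrightarrow> L i \<in> borel_measurable \<mu>"
    and L: "\<And>i x. i < d \<Longrightarrow> x \<in> space \<mu> \<Longrightarrow> L i x \<in> {0..1}"
    and v: "\<And>i. i < d \<Longrightarrow> v i \<in> V"
    and f: "\<And>x. x \<in> space \<mu> \<Longrightarrow> f x = (\<Sum>i<d. s (complex_of_real (L i x)) (v i))"
  shows "has_bochner_integral_on s V nrm \<mu> f w \<longleftrightarrow>
    w = (\<Sum>i<d. s (complex_of_real (\<integral>x. L i x \<partial>\<mu>)) (v i))"
proof -
  interpret finite_measure \<mu> by fact
  \<comment> \<open>\<open>u n x\<close> is the grid point below \<open>x\<close> scaled to integers, \<open>G n i\<close> scales its \<open>i\<close>-th entry back,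
    and \<open>F n\<close> maps the grid point to the vector it stands for.  Restricting to indices below \<open>d\<close>
    keeps the range of \<open>u n\<close> finite.\<close>
  define g where "g = (\<lambda>n i x. \<lfloor>real (Suc n) * L i x\<rfloor>)"
  define u where "u = (\<lambda>n x. \<lambda>i\<in>{..<d}. g n i x)"
  define G :: "nat \<Rightarrow> nat \<Rightarrow> (nat \<Rightarrow> int) \<Rightarrow> real" where "G = (\<lambda>n i z. real_of_int (z i) / real (Suc n))"
  define F where "F = (\<lambda>n z. \<Sum>i<d. s (complex_of_real (G n i z)) (v i))"
  define C where "C = (\<Sum>i<d. nrm (v i))"
  have u: "simple_function \<mu> (u n)" for n
    unfolding simple_function_def
  proof (intro conjI ballI)
    have "g n i x \<in> {0..int (Suc n)}" if "i < d" "x \<in> space \<mu>" for i x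
    proof -
      have "0 \<le> real (Suc n) * L i x" "real (Suc n) * L i x \<le> real (Suc n) * 1"
        using L[OF that] by (intro mult_nonneg_nonneg mult_left_mono; simp)+
      then have "0 \<le> g n i x" "g n i x \<le> \<lfloor>real (Suc n) * 1\<rfloor>"
        unfolding g_def by (simp_all only: zero_le_floor floor_mono)
      then show ?thesis by (simp only: mult_1_right floor_of_nat atLeastAtMost_iff simp_thms)
    qed
    then have "u n ` space \<mu> \<subseteq> (\<Pi>\<^sub>E i\<in>{..<d}. {0..int (Suc n)})"
      unfolding u_def by (intro image_subsetI) (simp add: restrict_PiE_iff)
    then show "finite (u n ` space \<mu>)"
      by (rule finite_subset) (intro finite_PiE; simp)
  next
    fix z assume "z \<in> u n ` space \<mu>"
    then have "z \<in> extensional {..<d}" by (auto simp: u_def)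
    then have "u n -` {z} \<inter> space \<mu> = {x \<in> space \<mu>. \<forall>i\<in>{..<d}. g n i x = z i}"
      by (auto simp: u_def fun_eq_iff extensional_def)
    moreover have "{x \<in> space \<mu>. \<forall>i\<in>{..<d}. g n i x = z i} \<in> sets \<mu>"
    proof (intro sets.sets_Collect_finite_All)
      fix i assume "i \<in> {..<d}"
      then have [measurable]: "L i \<in> borel_measurable \<mu>" using L_meas by simp
      have "{x \<in> space \<mu>. g n i x = z i} =
          {x \<in> space \<mu>. of_int (z i) \<le> real (Suc n) * L i x \<and> real (Suc n) * L i x < of_int (z i) + 1}"
        unfolding g_def by (auto simp: floor_eq_iff)
      also have "\<dots> \<in> sets \<mu>" by measurable
      finally show "{x \<in> space \<mu>. g n i x = z i} \<in> sets \<mu>" .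
    qed simp
    ultimately show "u n -` {z} \<inter> space \<mu> \<in> sets \<mu>" by simp
  qed
  have G: "\<bar>L i x - G n i (u n x)\<bar> \<le> inverse (real (Suc n))" if "i < d" for i x n
  proof -
    have "\<bar>real (Suc n) * L i x - real_of_int (g n i x)\<bar> \<le> 1"
      unfolding g_def by linarith
    then have "\<bar>real (Suc n) * L i x - real_of_int (g n i x)\<bar> / real (Suc n) \<le> 1 / real (Suc n)"
      by (rule divide_right_mono) simp
    moreover have "L i x - G n i (u n x) = (real (Suc n) * L i x - real_of_int (g n i x)) / real (Suc n)"
      using that by (simp add: G_def u_def diff_divide_distrib)
    ultimately show ?thesis by (simp add: abs_divide inverse_eq_divide)
  qed
  have F_V: "F n z \<in> V" for n z
    unfolding F_def using v subspace_V by (intro subspace_sum subspace_scale) auto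
  \<comment> \<open>This estimate serves twice: for the pointwise error, and for the error of the integrals.\<close>
  have comb_close: "nrm ((\<Sum>i<d. s (complex_of_real (b i)) (v i)) - (\<Sum>i<d. s (complex_of_real (c i)) (v i)))
      \<le> B * C" if "\<And>i. i < d \<Longrightarrow> \<bar>b i - c i\<bar> \<le> B" for b c B
  proof -
    have "nrm (\<Sum>i<d. s (complex_of_real (b i - c i)) (v i)) \<le> (\<Sum>i<d. cmod (complex_of_real (b i - c i)) * nrm (v i))"
      using v by (intro nrm_sum_scale_le) auto
    also have "\<dots> = (\<Sum>i<d. \<bar>b i - c i\<bar> * nrm (v i))"
      by (simp only: norm_of_real real_norm_def)
    also have "\<dots> \<le> (\<Sum>i<d. B * nrm (v i))"
      using that v by (intro sum_mono mult_right_mono) (auto intro: nrm_nonneg)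
    finally show ?thesis
      by (simp add: C_def sum_distrib_left scale_left_diff_distrib sum_subtractf)
  qed
  let ?w = "\<Sum>i<d. s (complex_of_real (\<integral>x. L i x \<partial>\<mu>)) (v i)"
  show ?thesis
  proof (rule has_bochner_integral_on_uniform_limit_iff[where T = "\<lambda>n x. F n (u n x)"
        and e = "\<lambda>n. inverse (real (Suc n)) * C"])
    show "f ` space \<mu> \<subseteq> V"
      using v subspace_V by (intro image_subsetI, subst f) (auto intro!: subspace_sum subspace_scale)
    show w_V: "?w \<in> V"
      using v subspace_V by (intro subspace_sum subspace_scale) auto
    show simple: "simple_map V \<mu> (\<lambda>x. F n (u n x))" for n
      unfolding simple_map_def using simple_function_compose1[OF u[of n], of "F n"]
      by (intro conjI image_subsetI F_V) (simp_all add: emeasure_eq_measure)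
    show "nrm (f x - F n (u n x)) \<le> inverse (real (Suc n)) * C" if "x \<in> space \<mu>" for n x
      unfolding F_def f[OF that] by (rule comb_close) (rule G)
    show "(\<lambda>n. inverse (real (Suc n)) * C) \<longlonglongrightarrow> 0"
      using tendsto_mult_right[OF LIMSEQ_inverse_real_of_nat, of C] by simp
    have int_L: "integrable \<mu> (L i)" if "i < d" for i
      using L_meas L that by (intro integrable_const_bound[of _ 1]) auto
    have upper: "nrm (simple_map_integral s \<mu> (\<lambda>x. F n (u n x)) - ?w)
        \<le> (inverse (real (Suc n)) * measure \<mu> (space \<mu>)) * C" for n
    proof -
      let ?m = "\<lambda>z. measure \<mu> {x\<in>space \<mu>. u n x = z}"
      have "simple_map_integral s \<mu> (\<lambda>x. F n (u n x)) = (\<Sum>z\<in>u n ` space \<mu>. s (?m z) (F n z))"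
        using u by (intro simple_map_integral_comp) (auto simp: finite_measure_axioms vector_space_axioms)
      also have "\<dots> = (\<Sum>i<d. s (complex_of_real (\<Sum>z\<in>u n ` space \<mu>. ?m z * G n i z)) (v i))"
        unfolding F_def scale_sum_right by (subst sum.swap) (simp add: scale_sum_left)
      also have "\<dots> = (\<Sum>i<d. s (complex_of_real (\<integral>x. G n i (u n x) \<partial>\<mu>)) (v i))"
        by (subst integral_comp_simple_function(2)[OF finite_measure_axioms u]) simp
      finally have eq: "simple_map_integral s \<mu> (\<lambda>x. F n (u n x)) = \<dots>" .
      show ?thesis
        unfolding eq
      proof (rule comb_close)
        fix i assume i: "i < d"
        note int_G = integral_comp_simple_function(1)[OF finite_measure_axioms u[of n], of "G n i"]
        have "\<bar>(\<integral>x. G n i (u n x) \<partial>\<mu>) - (\<integral>x. L i x \<partial>\<mu>)\<bar> = \<bar>\<integral>x. G n i (u n x) - L i x \<partial>\<mu>\<bar>"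
          using int_G int_L[OF i] by simp
        also have "\<dots> \<le> (\<integral>x. \<bar>G n i (u n x) - L i x\<bar> \<partial>\<mu>)"
          by (rule integral_abs_bound)
        also have "\<dots> \<le> (\<integral>x. inverse (real (Suc n)) \<partial>\<mu>)"
          using int_G int_L[OF i] G[OF i] by (intro integral_mono) (auto simp: abs_minus_commute)
        finally show "\<bar>(\<integral>x. G n i (u n x) \<partial>\<mu>) - (\<integral>x. L i x \<partial>\<mu>)\<bar> \<le> inverse (real (Suc n)) * measure \<mu> (space \<mu>)"
          by (simp add: mult.commute)
      qed
    qed
    have lim: "(\<lambda>n. (inverse (real (Suc n)) * measure \<mu> (space \<mu>)) * C) \<longlonglongrightarrow> 0"
      using tendsto_mult_right[OF LIMSEQ_inverse_real_of_nat, of "measure \<mu> (space \<mu>) * C"]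
      by (simp add: mult.assoc)
    have lower: "0 \<le> nrm (simple_map_integral s \<mu> (\<lambda>x. F n (u n x)) - ?w)" for n
      by (intro nrm_nonneg subspace_diff simple_map_integral_in subspace_V w_V simple)
    show "(\<lambda>n. nrm (simple_map_integral s \<mu> (\<lambda>x. F n (u n x)) - ?w)) \<longlonglongrightarrow> 0"
      by (rule tendsto_sandwich[OF always_eventually[OF allI, OF lower]
            always_eventually[OF allI, OF upper] tendsto_const lim])
  qed (fact finite_measure_axioms)
qed

end

section \<open>Coordinates, linear maps and duals\<close>

text \<open>
  The coordinate functionals of a basis are the functions \<^const>\<open>dual_basis\<close>.  They vanish outside
  the space because \<^const>\<open>module.representation\<close> does, so they are literally members of
  \<^const>\<open>dual_space\<close>.
\<close>

locale based_space = vector_space s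
  for s :: "complex \<Rightarrow> 'v \<Rightarrow> 'v::ab_group_add" +
  fixes V :: "'v set" and r :: nat and p :: "nat \<Rightarrow> 'v"
  assumes indexed_basis: "indexed_basis s V r p"
begin

abbreviation coord :: "nat \<Rightarrow> 'v \<Rightarrow> complex" where
  "coord \<equiv> dual_basis s r p"

lemma inj_basis: "inj_on p {..<r}"
  and independent_basis: "independent (p ` {..<r})"
  and span_basis: "span (p ` {..<r}) = V"
  using indexed_basis by (auto simp: indexed_basis_def)

lemma subspace_V: "subspace V"
  using subspace_span[of "p ` {..<r}"] span_basis by simp

lemma basis_in: "k < r \<Longrightarrow> p k \<in> V"
  unfolding span_basis[symmetric] by (intro span_base imageI) simp

lemma sum_coord: "x \<in> V \<Longrightarrow> (\<Sum>k<r. s (coord k x) (p k)) = x"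
  using sum_representation_eq[OF independent_basis, of x "p ` {..<r}"] span_basis
  unfolding dual_basis_def sum.reindex[OF inj_basis] by simp

lemma coord_sum_basis:
  assumes "j < r" shows "coord j (\<Sum>k<r. s (c k) (p k)) = c j"
proof -
  have in_span: "p k \<in> span (p ` {..<r})" if "k < r" for k
    using that by (intro span_base imageI) simp
  have "coord j (\<Sum>k<r. s (c k) (p k)) =
      (\<Sum>k<r. representation (p ` {..<r}) (s (c k) (p k)) (p j))"
    unfolding dual_basis_def using in_span
    by (subst representation_sum[OF independent_basis]) (auto intro: span_scale)
  also have "\<dots> = (\<Sum>k<r. if j = k then c k else 0)"
  proof (intro sum.cong refl)
    fix k assume "k \<in> {..<r}"
    then have k: "k < r" by simp
    have "representation (p ` {..<r}) (s (c k) (p k)) (p j) = c k * (if p j = p k then 1 else 0)"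
      using k by (simp add: representation_scale[OF independent_basis in_span]
          representation_basis[OF independent_basis])
    then show "representation (p ` {..<r}) (s (c k) (p k)) (p j) = (if j = k then c k else 0)"
      using k assms inj_basis by (auto simp: inj_on_eq_iff)
  qed
  finally show ?thesis using assms by simp
qed

lemma coord_basis:
  assumes "j < r" "k < r" shows "coord j (p k) = (if j = k then 1 else 0)"
proof -
  have "(\<Sum>i<r. s (if i = k then 1 else 0) (p i)) = (\<Sum>i<r. if i = k then p i else 0)"
    by (intro sum.cong) auto
  then have "(\<Sum>i<r. s (if i = k then 1 else 0) (p i)) = p k" using assms by simp
  moreover have "coord j (\<Sum>i<r. s (if i = k then 1 else 0) (p i)) = (if j = k then 1 else 0)"
    using assms by (intro coord_sum_basis)
  ultimately show ?thesis by simp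
qed

lemma coord_linear: "coord k \<in> dual_space s V"
proof -
  have "coord k (x + y) = coord k x + coord k y" if "x \<in> V" "y \<in> V" for x y
    using that span_basis by (simp add: dual_basis_def representation_add[OF independent_basis])
  moreover have "coord k (s c x) = c * coord k x" if "x \<in> V" for c x
    using that span_basis by (simp add: dual_basis_def representation_scale[OF independent_basis])
  moreover have "coord k x = 0" if "x \<notin> V" for x
    using that span_basis by (simp add: dual_basis_def representation_def)
  ultimately show ?thesis by (simp add: dual_space_def linear_maps_def)
qed

lemma coord_add: "x \<in> V \<Longrightarrow> y \<in> V \<Longrightarrow> coord k (x + y) = coord k x + coord k y"
  and coord_scale: "x \<in> V \<Longrightarrow> coord k (s c x) = c * coord k x"
  using coord_linear by (auto simp: dual_space_def linear_maps_def)

end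

lemma based_spaceI: "vector_space s \<Longrightarrow> indexed_basis s V r p \<Longrightarrow> based_space s V r p"
  by (simp add: based_space_def based_space_axioms_def)

lemma exists_indexed_basis:
  assumes "vector_space s" and "finite B"
  shows "\<exists>r p. indexed_basis s (module.span s B) r p"
proof -
  interpret vector_space s by fact
  obtain B' where B': "B' \<subseteq> B" "independent B'" "B \<subseteq> span B'"
    using maximal_independent_subset by blast
  have "span B' = span B"
    using B' span_minimal[of B "span B'"] span_mono[of B' B] subspace_span by auto
  moreover have "finite B'" using B' assms finite_subset by blast
  then obtain p where "bij_betw p {0..<card B'} B'"
    using ex_bij_betw_nat_finite by blast
  then have "inj_on p {..<card B'}" "p ` {..<card B'} = B'"
    by (auto simp: bij_betw_def atLeast0LessThan)
  ultimately show ?thesis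
    using B' unfolding indexed_basis_def by (intro exI[of _ "card B'"] exI[of _ p]) simp
qed

lemma linear_maps_sum:
  assumes "vector_space s" "vector_space t" "module.subspace s V"
    and f: "f \<in> linear_maps s V t W" and v: "\<And>i. i \<in> I \<Longrightarrow> v i \<in> V"
  shows "f (\<Sum>i\<in>I. s (c i) (v i)) = (\<Sum>i\<in>I. t (c i) (f (v i)))"
proof -
  interpret S: vector_space s by fact
  interpret T: vector_space t by fact
  have V: "S.subspace V" by fact
  have "f (s 0 0) = t 0 (f 0)" using f S.subspace_0[OF V] unfolding linear_maps_def by blast
  then have "f 0 = 0" by simp
  then show ?thesis using v
  proof (induction I rule: infinite_finite_induct)
    case (insert i I)
    have "f (s (c i) (v i) + (\<Sum>i\<in>I. s (c i) (v i))) = f (s (c i) (v i)) + f (\<Sum>i\<in>I. s (c i) (v i))"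
      using f insert.prems V S.subspace_scale S.subspace_sum[OF V, of I "\<lambda>i. s (c i) (v i)"]
      unfolding linear_maps_def by auto
    with insert f show ?case by (simp add: linear_maps_def)
  qed auto
qed

lemma vector_space_fun_scale:
  assumes "vector_space s" shows "vector_space (fun_scale s)"
proof -
  interpret vector_space s by fact
  show ?thesis
    by unfold_locales (auto simp: fun_scale_def fun_eq_iff scale_right_distrib scale_left_distrib)
qed

lemma subspace_linear_maps:
  assumes "vector_space s" "vector_space t" "module.subspace s V" "module.subspace t W"
  shows "module.subspace (fun_scale t) (linear_maps s V t W)"
proof -
  interpret S: vector_space s by fact
  interpret T: vector_space t by fact
  interpret F: vector_space "fun_scale t" using vector_space_fun_scale assms by blast
  show ?thesis
    using assms(3,4)
    by (auto simp: F.subspace_def S.subspace_def T.subspace_def linear_maps_def fun_scale_def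
        T.scale_right_distrib algebra_simps T.scale_left_commute)
qed

text \<open>
  The condition that describes \<^const>\<open>module_integral\<close> quantifies over all norms on the endomorphisms
  and would hold for every endomorphism if there were none.  The sum of the absolute values of the
  matrix entries is a norm.
\<close>

lemma exists_norm_on_endos:
  assumes "vector_space s" and "finite B"
  shows "\<exists>nrm. norm_on (fun_scale s) (endos s (module.span s B)) nrm"
proof -
  obtain r p where "indexed_basis s (module.span s B) r p"
    using exists_indexed_basis[OF assms] by blast
  then interpret based_space s "module.span s B" r p
    using assms by (intro based_spaceI)
  define nrm where "nrm T = (\<Sum>j<r. \<Sum>k<r. cmod (coord k (T (p j))))" for T
  let ?E = "endos s (span B)"
  have T_in: "T (p j) \<in> span B" if "T \<in> ?E" "j < r" for T j
    using that basis_in by (auto simp: linear_maps_def)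
  have "T = 0" if T: "T \<in> ?E" and 0: "nrm T = 0" for T
  proof
    fix x
    have "T (p j) = 0" if "j < r" for j
    proof -
      have "coord k (T (p j)) = 0" if "k < r" for k
        using 0 that \<open>j < r\<close> unfolding nrm_def by (auto simp: sum_nonneg_eq_0_iff sum_nonneg)
      then show ?thesis using sum_coord[OF T_in[OF T that]] by simp
    qed
    moreover have "T (\<Sum>k<r. s (coord k x) (p k)) = (\<Sum>k<r. s (coord k x) (T (p k)))"
      using T basis_in subspace_V vector_space_axioms by (intro linear_maps_sum) auto
    ultimately show "T x = 0 x"
      using sum_coord[of x] T by (cases "x \<in> span B") (auto simp: linear_maps_def)
  qed
  moreover have "nrm 0 = 0"
    using coord_sum_basis[of _ "\<lambda>_. 0"] by (simp add: nrm_def)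
  moreover have "nrm (T + U) \<le> nrm T + nrm U" if "T \<in> ?E" "U \<in> ?E" for T U
    unfolding nrm_def sum.distrib[symmetric] using that T_in
    by (intro sum_mono) (simp add: coord_add norm_triangle_ineq)
  moreover have "nrm (fun_scale s c T) = cmod c * nrm T" if "T \<in> ?E" for T c
    unfolding nrm_def sum_distrib_left using that T_in
    by (intro sum.cong) (simp_all add: fun_scale_def coord_scale norm_mult)
  moreover have "0 \<le> nrm T" for T
    unfolding nrm_def by (intro sum_nonneg) simp
  ultimately have "norm_on (fun_scale s) ?E nrm"
    unfolding norm_on_def by (intro conjI ballI allI iffI) simp_all
  then show ?thesis by blast
qed

lemma sum_fun_apply: "(\<Sum>i\<in>I. f i) x = (\<Sum>i\<in>I. f i x)"
  by (induction I rule: infinite_finite_induct) auto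

context based_space
begin

lemma coord_sum:
  assumes "\<And>i. i \<in> I \<Longrightarrow> v i \<in> V"
  shows "coord k (\<Sum>i\<in>I. s (c i) (v i)) = (\<Sum>i\<in>I. c i * coord k (v i))"
  by (rule linear_maps_sum[OF vector_space_axioms vector_space_over_itself.vector_space_axioms
        subspace_V coord_linear[unfolded dual_space_def]]) (rule assms)

lemma dual_space_expand:
  assumes "\<phi> \<in> dual_space s V"
  shows "\<phi> = (\<Sum>k<r. fun_scale (*) (\<phi> (p k)) (coord k))"
proof
  fix x
  show "\<phi> x = (\<Sum>k<r. fun_scale (*) (\<phi> (p k)) (coord k)) x"
  proof (cases "x \<in> V")
    case True
    have "\<phi> (\<Sum>k<r. s (coord k x) (p k)) = (\<Sum>k<r. coord k x * \<phi> (p k))"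
      by (rule linear_maps_sum[OF vector_space_axioms vector_space_over_itself.vector_space_axioms
            subspace_V assms[unfolded dual_space_def]]) (simp add: basis_in)
    then show ?thesis
      using True by (simp add: sum_coord sum_fun_apply fun_scale_def mult.commute)
  next
    case False
    have "coord k x = 0" for k using coord_linear False by (simp add: dual_space_def linear_maps_def)
    moreover have "\<phi> x = 0" using assms False by (simp add: dual_space_def linear_maps_def)
    ultimately show ?thesis by (simp add: sum_fun_apply fun_scale_def)
  qed
qed

lemma vector_space_dual: "vector_space (fun_scale ((*) :: complex \<Rightarrow> complex \<Rightarrow> complex))"
  by (rule vector_space_fun_scale[OF vector_space_over_itself.vector_space_axioms])

lemma subspace_dual_space: "module.subspace (fun_scale (*)) (dual_space s V)"
  unfolding dual_space_def
  by (intro subspace_linear_maps vector_space_axioms vector_space_over_itself.vector_space_axioms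
      subspace_V vector_space_over_itself.subspace_UNIV)

text \<open>
  Evaluation at \<open>p j\<close> isolates the \<open>j\<close>-th coefficient of a combination of coordinate functionals;
  this gives independence, and the expansion \<open>\<phi> = (\<Sum>k. \<phi> (p k) p k*)\<close> gives generation.
\<close>

lemma indexed_basis_dual: "indexed_basis (fun_scale (*)) (dual_space s V) r coord"
proof -
  interpret F: vector_space "fun_scale ((*) :: complex \<Rightarrow> complex \<Rightarrow> complex)" by (rule vector_space_dual)
  have inj: "inj_on coord {..<r}"
  proof (rule inj_onI)
    fix j k assume "j \<in> {..<r}" "k \<in> {..<r}" and eq: "coord j = coord k"
    then have jk: "j < r" "k < r" by simp_all
    have "coord k (p j) = 1" unfolding eq[symmetric] using jk by (simp add: coord_basis)
    then show "j = k" using jk by (simp add: coord_basis split: if_splits)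
  qed
  have "\<not> F.dependent (coord ` {..<r})"
  proof
    assume "F.dependent (coord ` {..<r})"
    then obtain u j where j: "j < r" "u (coord j) \<noteq> 0"
      and 0: "(\<Sum>\<phi>\<in>coord ` {..<r}. fun_scale (*) (u \<phi>) \<phi>) = 0"
      by (auto simp: F.dependent_finite)
    have "0 = (\<Sum>k<r. fun_scale (*) (u (coord k)) (coord k)) (p j)"
      using 0 by (simp add: sum.reindex[OF inj])
    also have "\<dots> = (\<Sum>k<r. if k = j then u (coord k) else 0)"
      unfolding sum_fun_apply fun_scale_def using j by (intro sum.cong) (auto simp: coord_basis)
    finally show False using j by simp
  qed
  moreover have "F.span (coord ` {..<r}) = dual_space s V"
  proof
    show "F.span (coord ` {..<r}) \<subseteq> dual_space s V"
      by (intro F.span_minimal subspace_dual_space) (auto simp: coord_linear)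
    show "dual_space s V \<subseteq> F.span (coord ` {..<r})"
    proof
      fix \<phi> assume "\<phi> \<in> dual_space s V"
      from dual_space_expand[OF this] show "\<phi> \<in> F.span (coord ` {..<r})"
        by (rule ssubst) (intro F.span_sum F.span_scale F.span_base imageI)
    qed
  qed
  ultimately show ?thesis using inj by (simp add: indexed_basis_def)
qed

lemma coord_dual:
  assumes "\<phi> \<in> dual_space s V" and "k < r"
  shows "dual_basis (fun_scale (*)) r coord k \<phi> = \<phi> (p k)"
proof -
  interpret D: based_space "fun_scale (*)" "dual_space s V" r coord
    by (rule based_spaceI[OF vector_space_dual indexed_basis_dual])
  show ?thesis
    by (subst dual_space_expand[OF assms(1)]) (rule D.coord_sum_basis[OF assms(2)])
qed

end

section \<open>The cube spanned by a basis\<close>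

lemma prob_space_lebesgue_cube: "prob_space (lebesgue_cube d)"
  using emeasure_lebesgue_cube by (rule prob_spaceI)

text \<open>
  Each coordinate of the cube is uniformly distributed on the unit interval, so its mean is
  \<open>\<integral> x dx = 1 / 2\<close> over \<open>{0..1}\<close>.
\<close>

lemma lebesgue_cube_component:
  assumes "i < d"
  shows measurable_lebesgue_cube_component: "(\<lambda>l. l i) \<in> borel_measurable (lebesgue_cube d)"
    and integral_lebesgue_cube_component: "(\<integral>l. l i \<partial>lebesgue_cube d) = 1 / 2"
proof -
  let ?U = "restrict_space lborel {0..1::real}"
  let ?P = "\<Pi>\<^sub>M i\<in>{..<d}. ?U"
  have U: "prob_space ?U"
    by (rule prob_spaceI) (simp add: space_restrict_space emeasure_restrict_space)
  have meas_U: "(\<lambda>x. x) \<in> borel_measurable ?U"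
    by (rule measurable_restrict_space1) simp
  have comp: "(\<lambda>l. l i) \<in> measurable ?P ?U"
    using assms by (intro measurable_component_singleton) simp
  have meas_P: "(\<lambda>l. l i) \<in> borel_measurable ?P"
    using measurable_compose[OF comp meas_U] .
  show "(\<lambda>l. l i) \<in> borel_measurable (lebesgue_cube d)"
    unfolding lebesgue_cube_def by (rule measurable_completion[OF meas_P])
  have "(\<integral>l. l i \<partial>lebesgue_cube d) = (\<integral>l. l i \<partial>?P)"
    unfolding lebesgue_cube_def by (rule integral_completion[OF meas_P])
  also have "\<dots> = (\<integral>x. x \<partial>distr ?P ?U (\<lambda>l. l i))"
    by (rule integral_distr[OF comp meas_U, symmetric])
  also have "distr ?P ?U (\<lambda>l. l i) = ?U"
    using U assms by (intro distr_PiM_component) auto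
  also have "(\<integral>x. x \<partial>?U) = (\<integral>x. indicator {0..1} x *\<^sub>R x \<partial>lborel)"
    by (rule integral_restrict_space) simp
  also have "\<dots> = (\<integral>x. x ^ 1 * indicator {0..1} x \<partial>lborel)"
    by (simp add: mult.commute)
  also have "\<dots> = 1 / 2"
    by (subst integral_power) simp_all
  finally show "(\<integral>l. l i \<partial>lebesgue_cube d) = 1 / 2" .
qed

context based_space
begin

lemma coord_lin_comb: "i < r \<Longrightarrow> coord i (lin_comb s r p l) = complex_of_real (l i)"
  unfolding lin_comb_def by (rule coord_sum_basis)

text \<open>
  Injectivity is what makes \<^const>\<open>embed_measure\<close> a transport of structure, and hence an image
  measure.  Points of the product space are extensional, so they are determined by their first \<open>r\<close>
  coordinates.
\<close>

lemma inj_on_lin_comb: "inj_on (lin_comb s r p) (space (lebesgue_cube r))"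
proof (rule inj_onI)
  fix l l' assume l: "l \<in> space (lebesgue_cube r)" and l': "l' \<in> space (lebesgue_cube r)"
    and eq: "lin_comb s r p l = lin_comb s r p l'"
  have "l \<in> extensional {..<r}" "l' \<in> extensional {..<r}"
    using l l' by (auto simp: lebesgue_cube_def space_PiM PiE_iff)
  then show "l = l'"
  proof (rule extensionalityI)
    fix i assume "i \<in> {..<r}"
    then show "l i = l' i"
      using coord_lin_comb[of i l] coord_lin_comb[of i l'] eq by simp
  qed
qed

lemma basis_cube_measure_eq_distr:
  "basis_cube_measure s r p =
    distr (lebesgue_cube r) (basis_cube_measure s r p) (lin_comb s r p)"
  unfolding basis_cube_measure_def by (rule embed_measure_eq_distr'[OF inj_on_lin_comb])

lemma measurable_lin_comb:
  "lin_comb s r p \<in> measurable (lebesgue_cube r) (basis_cube_measure s r p)"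
  unfolding basis_cube_measure_def by (rule measurable_embed_measure2'[OF inj_on_lin_comb])

lemma prob_space_basis_cube_measure: "prob_space (basis_cube_measure s r p)"
  by (subst basis_cube_measure_eq_distr)
    (rule prob_space.prob_space_distr[OF prob_space_lebesgue_cube measurable_lin_comb])

text \<open>
  On the cube the coordinates are real, so that the cube variable is the combination of the basis
  whose coefficients are the real parts of the coordinates.
\<close>

lemma basis_cube_coord:
  assumes "x \<in> space (basis_cube_measure s r p)"
  shows "i < r \<Longrightarrow> Re (coord i x) \<in> {0..1}"
    and "x = (\<Sum>i<r. s (complex_of_real (Re (coord i x))) (p i))"
proof -
  obtain l where x: "x = (\<Sum>i<r. s (complex_of_real (l i)) (p i))" and l: "\<forall>i<r. l i \<in> {0..1}"
    using assms unfolding space_basis_cube_measure by blast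
  have c: "Re (coord i x) = l i" if "i < r" for i
    unfolding x using that by (subst coord_sum_basis) simp_all
  show "i < r \<Longrightarrow> Re (coord i x) \<in> {0..1}" using c l by simp
  have "(\<Sum>i<r. s (complex_of_real (Re (coord i x))) (p i)) = (\<Sum>i<r. s (complex_of_real (l i)) (p i))"
    by (intro sum.cong) (simp_all add: c)
  then show "x = (\<Sum>i<r. s (complex_of_real (Re (coord i x))) (p i))"
    using x by simp
qed

lemma
  assumes i: "i < r"
  shows measurable_basis_cube_coord: "(\<lambda>x. Re (coord i x)) \<in> borel_measurable (basis_cube_measure s r p)"
    and integral_basis_cube_coord: "(\<integral>x. Re (coord i x) \<partial>basis_cube_measure s r p) = 1 / 2"
proof -
  have eq: "Re (coord i (lin_comb s r p l)) = l i" for l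
    using i by (simp add: coord_lin_comb)
  show meas: "(\<lambda>x. Re (coord i x)) \<in> borel_measurable (basis_cube_measure s r p)"
    unfolding basis_cube_measure_def
    using measurable_lebesgue_cube_component[OF i] by (intro measurable_embed_measure1) (simp add: eq)
  have "(\<integral>x. Re (coord i x) \<partial>basis_cube_measure s r p) =
      (\<integral>x. Re (coord i x) \<partial>distr (lebesgue_cube r) (basis_cube_measure s r p) (lin_comb s r p))"
    using basis_cube_measure_eq_distr by simp
  also have "\<dots> = (\<integral>l. Re (coord i (lin_comb s r p l)) \<partial>lebesgue_cube r)"
    by (rule integral_distr[OF measurable_lin_comb meas])
  also have "\<dots> = 1 / 2"
    unfolding eq by (rule integral_lebesgue_cube_component[OF i])
  finally show "(\<integral>x. Re (coord i x) \<partial>basis_cube_measure s r p) = 1 / 2" .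
qed

end

section \<open>The integral of a module is the action of the barycentre\<close>

context fd_left_module
begin

lemma structure_hom_in_endos: "structure_hom M act x \<in> endos sM M"
  using subspace act_closed act_add_right act_scale_right
  by (auto simp: linear_maps_def structure_hom_def V.subspace_def)

lemma structure_hom_linear:
  "structure_hom M act \<in> linear_maps sA UNIV (fun_scale sM) (endos sM M)"
  unfolding linear_maps_def[of sA UNIV]
  by (simp add: structure_hom_in_endos)
    (simp add: structure_hom_def fun_scale_def fun_eq_iff act_add_left act_scale_left)

lemma structure_hom_sum:
  "structure_hom M act (\<Sum>i\<in>I. sA (c i) (x i)) =
    (\<Sum>i\<in>I. fun_scale sM (c i) (structure_hom M act (x i)))"
  by (rule linear_maps_sum[OF A.vector_space_axioms vector_space_fun_scale[OF V.vector_space_axioms]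
        A.subspace_UNIV structure_hom_linear]) simp

text \<open>
  The structure homomorphism is linear, so on the cube it is the combination of the endomorphisms
  \<open>\<rho>(a i)\<close> with the coordinates as coefficients; each coordinate has mean \<open>1 / 2\<close>.  The integral of a
  module is therefore the action of the barycentre of the cube.
\<close>

lemma module_integral_eq:
  assumes "indexed_basis sA UNIV d a"
  shows "module_integral sA d a sM M act = structure_hom M act (\<Sum>i<d. sA (1 / 2) (a i))"
proof -
  interpret C: based_space sA UNIV d a
    using A.vector_space_axioms assms by (rule based_spaceI)
  interpret prob_space "basis_cube_measure sA d a" by (rule C.prob_space_basis_cube_measure)
  let ?T = "structure_hom M act (\<Sum>i<d. sA (1 / 2) (a i))"
  have iff: "has_bochner_integral_on (fun_scale sM) (endos sM M) nrm
      (basis_cube_measure sA d a) (structure_hom M act) T \<longleftrightarrow> T = ?T"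
    if "norm_on (fun_scale sM) (endos sM M) nrm" for nrm T
  proof -
    interpret E: normed_subspace "fun_scale sM" "endos sM M" nrm
      unfolding normed_subspace_def normed_subspace_axioms_def
      by (intro conjI vector_space_fun_scale V.vector_space_axioms subspace_linear_maps subspace that)
    have "has_bochner_integral_on (fun_scale sM) (endos sM M) nrm
        (basis_cube_measure sA d a) (structure_hom M act) T \<longleftrightarrow>
      T = (\<Sum>i<d. fun_scale sM (complex_of_real
        (\<integral>x. Re (C.coord i x) \<partial>basis_cube_measure sA d a)) (structure_hom M act (a i)))"
    proof (rule E.has_bochner_integral_on_combination_iff)
      fix x assume "x \<in> space (basis_cube_measure sA d a)"
      from C.basis_cube_coord(2)[OF this]
      show "structure_hom M act x = (\<Sum>i<d. fun_scale sM (complex_of_real (Re (C.coord i x)))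
          (structure_hom M act (a i)))"
        by (metis structure_hom_sum)
    qed (use C.measurable_basis_cube_coord C.basis_cube_coord(1) structure_hom_in_endos
        finite_measure_axioms in auto)
    also have "(\<Sum>i<d. fun_scale sM (complex_of_real
        (\<integral>x. Re (C.coord i x) \<partial>basis_cube_measure sA d a)) (structure_hom M act (a i))) =
        (\<Sum>i<d. fun_scale sM (1 / 2) (structure_hom M act (a i)))"
      by (intro sum.cong) (simp_all add: C.integral_basis_cube_coord)
    finally show ?thesis by (simp only: structure_hom_sum)
  qed
  obtain B where "finite B" "V.span B = M" using finite_dim by blast
  then obtain nrm where nrm: "norm_on (fun_scale sM) (endos sM M) nrm"
    using exists_norm_on_endos[OF V.vector_space_axioms] by metis
  show ?thesis
    unfolding module_integral_def
  proof (rule the_equality)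
    show "?T \<in> endos sM M \<and> (\<forall>nrm. norm_on (fun_scale sM) (endos sM M) nrm \<longrightarrow>
        has_bochner_integral_on (fun_scale sM) (endos sM M) nrm
          (basis_cube_measure sA d a) (structure_hom M act) ?T)"
      using iff structure_hom_in_endos by simp
    show "T = ?T" if "T \<in> endos sM M \<and> (\<forall>nrm. norm_on (fun_scale sM) (endos sM M) nrm \<longrightarrow>
        has_bochner_integral_on (fun_scale sM) (endos sM M) nrm
          (basis_cube_measure sA d a) (structure_hom M act) T)" for T
      using iff[OF nrm] that nrm by blast
  qed
qed

end

section \<open>Matrices and similarity\<close>

text \<open>
  The matrix of a map between two spaces with chosen bases.  Unlike \<^const>\<open>matrix_of\<close> it may be
  rectangular, as is needed for an isomorphism before the two dimensions are known to agree.
\<close>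

definition coord_matrix ::
    "nat \<Rightarrow> (nat \<Rightarrow> 'v) \<Rightarrow> (complex \<Rightarrow> 'w \<Rightarrow> 'w) \<Rightarrow> nat \<Rightarrow> (nat \<Rightarrow> 'w::ab_group_add)
      \<Rightarrow> ('v \<Rightarrow> 'w) \<Rightarrow> complex mat" where
  "coord_matrix r p t m q f = Matrix.mat m r (\<lambda>(k, j). dual_basis t m q k (f (p j)))"

lemma coord_matrix_carrier: "coord_matrix r p t m q f \<in> carrier_mat m r"
  by (simp add: coord_matrix_def)

lemma matrix_of_eq_coord_matrix: "matrix_of s r p T = coord_matrix r p s r p T"
  by (simp add: matrix_of_def coord_matrix_def dual_basis_def)

lemma coord_matrix_cong:
  "(\<And>j. j < r \<Longrightarrow> f (p j) = g (p j)) \<Longrightarrow> coord_matrix r p t m q f = coord_matrix r p t m q g"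
  unfolding coord_matrix_def by (intro eq_matI) auto

lemma coord_matrix_comp:
  assumes "based_space s V r p" "based_space t W m q" "based_space t' X n w"
    and f: "\<And>x. x \<in> V \<Longrightarrow> f x \<in> W" and g: "g \<in> linear_maps t W t' X"
  shows "coord_matrix r p t' n w (\<lambda>x. g (f x)) = coord_matrix m q t' n w g * coord_matrix r p t m q f"
proof -
  interpret P: based_space s V r p by fact
  interpret Q: based_space t W m q by fact
  interpret R: based_space t' X n w by fact
  have gq: "g (q i) \<in> X" if "i < m" for i
    using g Q.basis_in[OF that] by (simp add: linear_maps_def)
  have "R.coord k (g (f (p j))) = (\<Sum>i<m. R.coord k (g (q i)) * Q.coord i (f (p j)))" if "j < r" for k j
  proof -
    have "f (p j) \<in> W" using that f P.basis_in by blast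
    then have "g (f (p j)) = g (\<Sum>i<m. t (Q.coord i (f (p j))) (q i))" by (simp only: Q.sum_coord)
    also have "\<dots> = (\<Sum>i<m. t' (Q.coord i (f (p j))) (g (q i)))"
      by (rule linear_maps_sum[OF Q.vector_space_axioms R.vector_space_axioms Q.subspace_V g])
        (simp add: Q.basis_in)
    also have "R.coord k \<dots> = (\<Sum>i<m. Q.coord i (f (p j)) * R.coord k (g (q i)))"
      by (rule R.coord_sum) (simp add: gq)
    finally show ?thesis by (simp only: mult.commute)
  qed
  then show ?thesis
    unfolding coord_matrix_def by (intro eq_matI) (auto simp: scalar_prod_def atLeast0LessThan)
qed

lemma coord_matrix_id:
  assumes "based_space s V r p" shows "coord_matrix r p s r p (\<lambda>x. x) = 1\<^sub>m r"
proof -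
  interpret based_space s V r p by fact
  show ?thesis unfolding coord_matrix_def by (intro eq_matI) (auto simp: coord_basis)
qed

text \<open>
  The traces of \<open>P * Q\<close> and \<open>Q * P\<close> agree, and the trace of an identity matrix is its size.
\<close>

lemma two_sided_inverse_mat_dims:
  fixes P Q :: "complex mat"
  assumes P: "P \<in> carrier_mat n m" and Q: "Q \<in> carrier_mat m n"
    and PQ: "P * Q = 1\<^sub>m n" and QP: "Q * P = 1\<^sub>m m"
  shows "n = m"
proof -
  have "of_nat n = (\<Sum>i<n. (P * Q) $$ (i, i))"
    unfolding PQ by simp
  also have "\<dots> = (\<Sum>i<n. \<Sum>k<m. P $$ (i, k) * Q $$ (k, i))"
    using P Q by (intro sum.cong) (auto simp: scalar_prod_def atLeast0LessThan)
  also have "\<dots> = (\<Sum>k<m. \<Sum>i<n. Q $$ (k, i) * P $$ (i, k))"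
    by (subst sum.swap) (simp add: mult.commute)
  also have "\<dots> = (\<Sum>k<m. (Q * P) $$ (k, k))"
    using P Q by (intro sum.cong) (auto simp: scalar_prod_def atLeast0LessThan)
  also have "\<dots> = (of_nat m :: complex)"
    unfolding QP by simp
  finally show ?thesis by simp
qed

lemma linear_maps_the_inv:
  assumes "vector_space s" "module.subspace s V"
    and h: "h \<in> linear_maps s V t W" and bij: "bij_betw h V W"
  shows "(\<lambda>y. if y \<in> W then the_inv_into V h y else 0) \<in> linear_maps t W s V"
proof -
  interpret vector_space s by fact
  have V: "subspace V" by fact
  let ?g = "the_inv_into V h"
  have inj: "inj_on h V" and W: "W = h ` V" using bij by (auto simp: bij_betw_def)
  have gh: "?g (h x) = x" if "x \<in> V" for x using inj that by (rule the_inv_into_f_f)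
  have add: "h (x + y) = h x + h y" "x + y \<in> V" if "x \<in> V" "y \<in> V" for x y
    using h that V by (auto simp: linear_maps_def subspace_add)
  have scale: "h (s c x) = t c (h x)" "s c x \<in> V" if "x \<in> V" for c x
    using h that V by (auto simp: linear_maps_def subspace_scale)
  have "h x + h y \<in> W" "?g (h x + h y) = x + y" if "x \<in> V" "y \<in> V" for x y
    using add[OF that] gh[of "x + y"] by (simp_all add: W rev_image_eqI)
  moreover have "t c (h x) \<in> W" "?g (t c (h x)) = s c x" if "x \<in> V" for c x
    using scale[OF that, of c] gh[of "s c x"] by (simp_all add: W rev_image_eqI)
  ultimately show ?thesis
    using gh unfolding linear_maps_def by (auto simp: W)
qed

text \<open>
  The matrix of the isomorphism \<open>h\<close> and that of its inverse conjugate the matrix of \<open>S\<close> into that of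
  \<open>T = h \<circ> S \<circ> h\<inverse>\<close>.
\<close>

lemma similar_mat_of_isomorphic:
  assumes M: "based_space s V r p" and N: "based_space t W r' q"
    and h: "h \<in> linear_maps s V t W" and bij: "bij_betw h V W"
    and S: "S \<in> endos s V" and T: "\<And>x. x \<in> V \<Longrightarrow> T (h x) = h (S x)"
  shows "similar_mat (matrix_of t r' q T) (matrix_of s r p S)"
proof -
  interpret M: based_space s V r p by fact
  interpret N: based_space t W r' q by fact
  \<comment> \<open>The value 0 outside \<open>W\<close> is the normalisation demanded by \<^const>\<open>linear_maps\<close>.\<close>
  define g where "g = (\<lambda>y. if y \<in> W then the_inv_into V h y else 0)"
  have g: "g \<in> linear_maps t W s V"
    unfolding g_def by (rule linear_maps_the_inv[OF M.vector_space_axioms M.subspace_V h bij])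
  have hV: "h x \<in> W" if "x \<in> V" for x using h that by (simp add: linear_maps_def)
  have gW: "g y \<in> V" if "y \<in> W" for y using g that by (simp add: linear_maps_def)
  have SV: "S x \<in> V" if "x \<in> V" for x using S that by (simp add: linear_maps_def)
  have gh: "g (h x) = x" if "x \<in> V" for x
    using that bij hV by (simp add: g_def bij_betw_def the_inv_into_f_f)
  have hg: "h (g y) = y" if "y \<in> W" for y
    using that bij by (simp add: g_def bij_betw_def f_the_inv_into_f)
  let ?P = "coord_matrix r p t r' q h" and ?Q = "coord_matrix r' q s r p g"
  have PQ: "?P * ?Q = 1\<^sub>m r'"
    using coord_matrix_comp[OF N M N gW h] coord_matrix_id[OF N]
      coord_matrix_cong[of r' "\<lambda>y. h (g y)" q "\<lambda>y. y" t r' q] hg N.basis_in by simp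
  have QP: "?Q * ?P = 1\<^sub>m r"
    using coord_matrix_comp[OF M N M hV g] coord_matrix_id[OF M]
      coord_matrix_cong[of r "\<lambda>y. g (h y)" p "\<lambda>y. y" s r p] gh M.basis_in by simp
  have "r' = r"
    by (rule two_sided_inverse_mat_dims[OF coord_matrix_carrier coord_matrix_carrier PQ QP])
  have "matrix_of t r' q T = coord_matrix r' q t r' q (\<lambda>y. h (S (g y)))"
    unfolding matrix_of_eq_coord_matrix
    using T[OF gW[OF N.basis_in]] hg[OF N.basis_in] by (intro coord_matrix_cong) simp
  also have "\<dots> = ?P * coord_matrix r' q s r p (\<lambda>y. S (g y))"
    by (rule coord_matrix_comp[OF N M N _ h]) (simp add: SV gW)
  also have "coord_matrix r' q s r p (\<lambda>y. S (g y)) = coord_matrix r p s r p S * ?Q"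
    by (rule coord_matrix_comp[OF N M M gW S])
  also have "?P * (coord_matrix r p s r p S * ?Q) = ?P * matrix_of s r p S * ?Q"
    unfolding matrix_of_eq_coord_matrix by (rule assoc_mult_mat[symmetric]) (rule coord_matrix_carrier)+
  finally have "matrix_of t r' q T = ?P * matrix_of s r p S * ?Q" .
  moreover have "{matrix_of t r' q T, matrix_of s r p S, ?P, ?Q} \<subseteq> carrier_mat r r"
    using \<open>r' = r\<close> by (simp add: matrix_of_eq_coord_matrix coord_matrix_def)
  ultimately show ?thesis
    using PQ QP \<open>r' = r\<close> by (intro similar_matI) auto
qed

section \<open>Direct sums\<close>

lemma dsum_carrier_eq_sum:
  assumes "f \<in> dsum_carrier n M"
  shows "f = (\<Sum>i<n. (\<lambda>j. if j = i then f i else 0))"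
proof
  fix j
  show "f j = (\<Sum>i<n. (\<lambda>j. if j = i then f i else 0)) j"
    using assms by (cases "j < n") (auto simp: sum_fun_apply dsum_carrier_def)
qed

text \<open>
  The images of spanning sets of the summands under the inclusions span the direct sum: the vectors
  that an inclusion maps into the span form a subspace containing a spanning set of the summand.
\<close>

lemma finite_dim_dsum:
  assumes "vector_space s" and "\<And>i. i < n \<Longrightarrow> \<exists>B. finite B \<and> module.span s B = M i"
  shows "\<exists>B. finite B \<and> module.span (fun_scale s) B = dsum_carrier n M"
proof -
  interpret S: vector_space s by fact
  interpret F: vector_space "fun_scale s :: complex \<Rightarrow> (nat \<Rightarrow> 'a) \<Rightarrow> _"
    using vector_space_fun_scale assms by blast
  obtain B where B: "\<And>i. i < n \<Longrightarrow> finite (B i) \<and> S.span (B i) = M i" using assms(2) by metis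
  have M: "S.subspace (M i)" if "i < n" for i using B[OF that] S.subspace_span by metis
  define inc where "inc i v = (\<lambda>j::nat. if j = i then v else 0)" for i and v :: 'a
  let ?S = "\<Union>i<n. inc i ` B i"
  have D: "F.subspace (dsum_carrier n M)"
    using M by (auto simp: F.subspace_def S.subspace_def dsum_carrier_def fun_scale_def)
  have inc_D: "inc i v \<in> dsum_carrier n M" if "i < n" "v \<in> M i" for i v
    using that M S.subspace_0 by (auto simp: inc_def dsum_carrier_def)
  have "F.span ?S = dsum_carrier n M"
  proof
    show "F.span ?S \<subseteq> dsum_carrier n M"
      using B S.span_base by (intro F.span_minimal D) (auto intro!: inc_D)
    have "inc i v \<in> F.span ?S" if "i < n" "v \<in> M i" for i v
    proof -
      have "S.subspace {v. inc i v \<in> F.span ?S}"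
      proof (rule S.subspaceI)
        have "inc i 0 = 0" by (auto simp: inc_def)
        then show "0 \<in> {v. inc i v \<in> F.span ?S}" by (simp add: F.span_zero)
      next
        fix x y assume "x \<in> {v. inc i v \<in> F.span ?S}" "y \<in> {v. inc i v \<in> F.span ?S}"
        moreover have "inc i (x + y) = inc i x + inc i y" by (auto simp: inc_def)
        ultimately show "x + y \<in> {v. inc i v \<in> F.span ?S}" by (simp add: F.span_add)
      next
        fix c x assume "x \<in> {v. inc i v \<in> F.span ?S}"
        moreover have "inc i (s c x) = fun_scale s c (inc i x)" by (auto simp: inc_def fun_scale_def)
        ultimately show "s c x \<in> {v. inc i v \<in> F.span ?S}" by (simp add: F.span_scale)
      qed
      moreover have "B i \<subseteq> {v. inc i v \<in> F.span ?S}"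
        using that by (auto intro!: F.span_base)
      ultimately have "S.span (B i) \<subseteq> {v. inc i v \<in> F.span ?S}"
        by (intro S.span_minimal)
      then show ?thesis using B that by blast
    qed
    then show "dsum_carrier n M \<subseteq> F.span ?S"
    proof (intro subsetI)
      fix f assume f: "f \<in> dsum_carrier n M"
      assume inc: "\<And>i v. i < n \<Longrightarrow> v \<in> M i \<Longrightarrow> inc i v \<in> F.span ?S"
      have "(\<Sum>i<n. inc i (f i)) \<in> F.span ?S"
        using f inc by (intro F.span_sum) (auto simp: dsum_carrier_def)
      then show "f \<in> F.span ?S"
        using dsum_carrier_eq_sum[OF f] by (simp add: inc_def)
    qed
  qed
  then show ?thesis using B by (intro exI[of _ ?S]) auto
qed

lemma fd_left_module_dsum:
  assumes "complex_algebra sA" and "vector_space s"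
    and M: "\<And>i. i < n \<Longrightarrow> fd_left_module sA s (M i) (act i)"
  shows "fd_left_module sA (fun_scale s) (dsum_carrier n M) (dsum_act n act)"
proof -
  interpret A: complex_algebra sA by fact
  interpret S: vector_space s by fact
  interpret F: vector_space "fun_scale s :: complex \<Rightarrow> (nat \<Rightarrow> 'b) \<Rightarrow> _"
    using vector_space_fun_scale assms by blast
  have fin: "\<exists>B. finite B \<and> F.span B = dsum_carrier n M"
    using M by (intro finite_dim_dsum assms fd_left_module.finite_dim)
  then have "F.subspace (dsum_carrier n M)" using F.subspace_span by metis
  with fin show ?thesis
    by unfold_locales
      (simp_all add: dsum_carrier_def dsum_act_def fun_scale_def fun_eq_iff
        fd_left_module.act_closed[OF M] fd_left_module.act_add_left[OF M]
        fd_left_module.act_add_right[OF M] fd_left_module.act_scale_left[OF M]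
        fd_left_module.act_scale_right[OF M] fd_left_module.act_mult[OF M] fd_left_module.act_one[OF M])
qed

section \<open>Left ideals and duals of right ideals\<close>

lemma fd_left_module_left_ideal:
  assumes "complex_algebra sA" and "indexed_basis sA (left_ideal_of e) r p"
  shows "fd_left_module sA sA (left_ideal_of e) (*)"
proof -
  interpret A: complex_algebra sA by fact
  interpret based_space sA "left_ideal_of e" r p
    using assms A.vector_space_axioms by (intro based_spaceI)
  have "\<exists>B. finite B \<and> A.span B = left_ideal_of e" using span_basis by blast
  moreover have "x * m \<in> left_ideal_of e" if "m \<in> left_ideal_of e" for x m
    using that unfolding left_ideal_of_def by (auto simp flip: mult.assoc)
  ultimately show ?thesis
    using subspace_V by unfold_locales
      (auto simp: algebra_simps A.scale_mult_left A.scale_mult_right mult.assoc)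
qed

lemma right_ideal_mult: "y \<in> right_ideal_of e \<Longrightarrow> y * x \<in> right_ideal_of e"
  for x e :: "'a::semigroup_mult"
  unfolding right_ideal_of_def by (auto simp: mult.assoc)

lemma fd_left_module_dual_right_ideal:
  assumes "complex_algebra sA" and "indexed_basis sA (right_ideal_of e) r p"
  shows "fd_left_module sA (fun_scale (*)) (dual_space sA (right_ideal_of e)) (dual_act (right_ideal_of e))"
proof -
  interpret A: complex_algebra sA by fact
  interpret based_space sA "right_ideal_of e" r p
    using assms A.vector_space_axioms by (intro based_spaceI)
  interpret D: based_space "fun_scale (*)" "dual_space sA (right_ideal_of e)" r coord
    by (rule based_spaceI[OF vector_space_dual indexed_basis_dual])
  have "\<exists>B. finite B \<and> D.span B = dual_space sA (right_ideal_of e)" using D.span_basis by blast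
  then show ?thesis
    using D.subspace_V subspace_V
    by unfold_locales
      (auto simp: dual_space_def linear_maps_def dual_act_def fun_scale_def fun_eq_iff right_ideal_mult
        A.subspace_add[OF subspace_V] A.subspace_scale[OF subspace_V] distrib_left distrib_right A.scale_mult_left A.scale_mult_right mult.assoc)
qed

section \<open>Similarity, direct sums and explicit matrices\<close>

text \<open>
  An isomorphism of modules intertwines the actions of every element, in particular of the barycentre.
\<close>

lemma similar_module_integrals:
  assumes a: "indexed_basis sA UNIV d a"
    and M: "fd_left_module sA sM M actM" and N: "fd_left_module sA sN N actN"
    and iso: "isomorphic_modules sM M actM sN N actN"
    and p: "indexed_basis sM M r p" and q: "indexed_basis sN N r' q"
  shows "similar_mat (matrix_of sN r' q (module_integral sA d a sN N actN))
                     (matrix_of sM r p (module_integral sA d a sM M actM))"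
proof -
  interpret M: fd_left_module sA sM M actM by fact
  interpret N: fd_left_module sA sN N actN by fact
  obtain h where h: "h \<in> linear_maps sM M sN N" and bij: "bij_betw h M N"
    and equivariant: "\<And>x m. m \<in> M \<Longrightarrow> h (actM x m) = actN x (h m)"
    using iso unfolding isomorphic_modules_def by blast
  show ?thesis
    unfolding M.module_integral_eq[OF a] N.module_integral_eq[OF a]
  proof (rule similar_mat_of_isomorphic[OF _ _ h bij M.structure_hom_in_endos])
    show "based_space sM M r p" using M.V.vector_space_axioms p by (rule based_spaceI)
    show "based_space sN N r' q" using N.V.vector_space_axioms q by (rule based_spaceI)
    fix m assume "m \<in> M"
    moreover from this have "h m \<in> N" using h by (simp add: linear_maps_def)
    ultimately show "structure_hom N actN (\<Sum>i<d. sA (1 / 2) (a i)) (h m) =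
        h (structure_hom M actM (\<Sum>i<d. sA (1 / 2) (a i)) m)"
      by (simp add: structure_hom_def equivariant)
  qed
qed

lemma module_integral_dsum:
  assumes "complex_algebra sA" and a: "indexed_basis sA UNIV d a" and "vector_space sV"
    and M: "\<And>i. i < n \<Longrightarrow> fd_left_module sA sV (M i) (act i)"
  shows "module_integral sA d a (fun_scale sV) (dsum_carrier n M) (dsum_act n act) =
    dsum_endo n M (\<lambda>i. module_integral sA d a sV (M i) (act i))"
proof -
  interpret fd_left_module sA "fun_scale sV" "dsum_carrier n M" "dsum_act n act"
    using assms by (intro fd_left_module_dsum)
  show ?thesis
    unfolding module_integral_eq[OF a] structure_hom_def[of "dsum_carrier n M"] dsum_endo_def dsum_act_def
    using M by (auto simp: fun_eq_iff fd_left_module.module_integral_eq[OF M a] structure_hom_def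
        dsum_carrier_def)
qed

lemma module_integral_left_ideal:
  assumes "complex_algebra sA" and a: "indexed_basis sA UNIV d a"
    and p: "indexed_basis sA (left_ideal_of e) r p"
    and l: "\<And>i j. i < d \<Longrightarrow> j < r \<Longrightarrow> a i * p j = (\<Sum>k<r. sA (l i j k) (p k))"
  shows "matrix_of sA r p (module_integral sA d a sA (left_ideal_of e) (*)) =
    Matrix.mat r r (\<lambda>(k, j). 1 / 2 * (\<Sum>i<d. l i j k))"
proof -
  interpret fd_left_module sA sA "left_ideal_of e" "(*)"
    using assms(1) p by (rule fd_left_module_left_ideal)
  interpret P: based_space sA "left_ideal_of e" r p
    using A.vector_space_axioms p by (rule based_spaceI)
  have entry: "P.coord k ((\<Sum>i<d. sA (1 / 2) (a i)) * p j) = 1 / 2 * (\<Sum>i<d. l i j k)"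
    if "k < r" "j < r" for k j
  proof -
    have "P.coord k ((\<Sum>i<d. sA (1 / 2) (a i)) * p j) = P.coord k (\<Sum>i<d. sA (1 / 2) (a i * p j))"
      by (simp add: sum_distrib_right A.scale_mult_left)
    also have "\<dots> = (\<Sum>i<d. 1 / 2 * P.coord k (a i * p j))"
      by (rule P.coord_sum) (rule act_closed[OF P.basis_in[OF that(2)]])
    also have "\<dots> = (\<Sum>i<d. 1 / 2 * l i j k)"
      using that by (intro sum.cong) (simp_all add: l P.coord_sum_basis)
    finally show ?thesis by (simp only: sum_distrib_left)
  qed
  show ?thesis
    unfolding matrix_of_eq_coord_matrix coord_matrix_def module_integral_eq[OF a] structure_hom_def
    by (intro eq_matI) (simp_all add: P.basis_in entry)
qed

text \<open>
  Writing \<open>h\<close> for the barycentre, the action of \<open>h\<close> on the dual is precomposition with right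
  multiplication by \<open>h\<close>, and the \<open>j\<close>-th coordinate of a functional in the dual basis is its value at
  \<open>p j\<close>.  The entry in row \<open>j\<close> and column \<open>k\<close> is thus the \<open>k\<close>-th coordinate of \<open>p j * h\<close>: this is the
  transpose of the matrix of right multiplication by \<open>h\<close> on the right ideal.
\<close>

lemma module_integral_dual_right_ideal:
  assumes "complex_algebra sA" and a: "indexed_basis sA UNIV d a"
    and p: "indexed_basis sA (right_ideal_of e) r p"
    and m: "\<And>i j. i < d \<Longrightarrow> j < r \<Longrightarrow> p j * a i = (\<Sum>k<r. sA (m i j k) (p k))"
  shows "matrix_of (fun_scale (*)) r (dual_basis sA r p)
      (module_integral sA d a (fun_scale (*)) (dual_space sA (right_ideal_of e))
        (dual_act (right_ideal_of e))) =
    Matrix.mat r r (\<lambda>(j, k). 1 / 2 * (\<Sum>i<d. m i j k))"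
proof -
  interpret fd_left_module sA "fun_scale (*)" "dual_space sA (right_ideal_of e)" "dual_act (right_ideal_of e)"
    using assms(1) p by (rule fd_left_module_dual_right_ideal)
  interpret P: based_space sA "right_ideal_of e" r p
    using A.vector_space_axioms p by (rule based_spaceI)
  let ?h = "\<Sum>i<d. sA (1 / 2) (a i)"
  have entry: "P.coord k (p j * ?h) = 1 / 2 * (\<Sum>i<d. m i j k)" if "k < r" "j < r" for k j
  proof -
    have "P.coord k (p j * ?h) = P.coord k (\<Sum>i<d. sA (1 / 2) (p j * a i))"
      by (simp add: sum_distrib_left A.scale_mult_right)
    also have "\<dots> = (\<Sum>i<d. 1 / 2 * P.coord k (p j * a i))"
      by (rule P.coord_sum) (rule right_ideal_mult[OF P.basis_in[OF that(2)]])
    also have "\<dots> = (\<Sum>i<d. 1 / 2 * m i j k)"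
      using that by (intro sum.cong) (simp_all add: m P.coord_sum_basis)
    finally show ?thesis by (simp only: sum_distrib_left)
  qed
  have "dual_basis (fun_scale (*)) r P.coord j (dual_act (right_ideal_of e) ?h (P.coord k)) =
      1 / 2 * (\<Sum>i<d. m i j k)" if "k < r" "j < r" for k j
  proof -
    have "dual_basis (fun_scale (*)) r P.coord j (dual_act (right_ideal_of e) ?h (P.coord k)) =
        dual_act (right_ideal_of e) ?h (P.coord k) (p j)"
      by (rule P.coord_dual[OF act_closed[OF P.coord_linear] that(2)])
    also have "\<dots> = P.coord k (p j * ?h)"
      by (simp add: dual_act_def P.basis_in that)
    finally show ?thesis using entry[OF that] by simp
  qed
  then show ?thesis
    unfolding matrix_of_eq_coord_matrix coord_matrix_def module_integral_eq[OF a] structure_hom_def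
    by (intro eq_matI) (simp_all add: P.coord_linear)
qed

theorem theorem2:
  fixes sA :: "complex \<Rightarrow> 'a::{ring, monoid_mult} \<Rightarrow> 'a"
    and d :: nat and a :: "nat \<Rightarrow> 'a"
  assumes "complex_algebra sA"
    and "indexed_basis sA UNIV d a"
  shows
    "(\<forall>(sM :: complex \<Rightarrow> 'm::ab_group_add \<Rightarrow> 'm) M actM
       (sN :: complex \<Rightarrow> 'n::ab_group_add \<Rightarrow> 'n) N actN r p r' q.
        fd_left_module sA sM M actM \<and> fd_left_module sA sN N actN \<and>
        isomorphic_modules sM M actM sN N actN \<and>
        indexed_basis sM M r p \<and> indexed_basis sN N r' q \<longrightarrow>
        similar_mat (matrix_of sN r' q (module_integral sA d a sN N actN))
                    (matrix_of sM r p (module_integral sA d a sM M actM)))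
   \<and> (\<forall>(sV :: complex \<Rightarrow> 'v::ab_group_add \<Rightarrow> 'v) n M act.
        vector_space sV \<and> (\<forall>i<n. fd_left_module sA sV (M i) (act i)) \<longrightarrow>
        module_integral sA d a (fun_scale sV) (dsum_carrier n M) (dsum_act n act) =
        dsum_endo n M (\<lambda>i. module_integral sA d a sV (M i) (act i)))
   \<and> (\<forall>e r p (l :: nat \<Rightarrow> nat \<Rightarrow> nat \<Rightarrow> complex).
        e \<noteq> 0 \<and> e * e = e \<and> indexed_basis sA (left_ideal_of e) r p \<and>
        (\<forall>i<d. \<forall>j<r. a i * p j = (\<Sum>k<r. sA (l i j k) (p k))) \<longrightarrow>
        matrix_of sA r p (module_integral sA d a sA (left_ideal_of e) (*)) =
        Matrix.mat r r (\<lambda>(k, j). 1 / 2 * (\<Sum>i<d. l i j k)))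
   \<and> (\<forall>e r p (m :: nat \<Rightarrow> nat \<Rightarrow> nat \<Rightarrow> complex).
        e \<noteq> 0 \<and> e * e = e \<and> indexed_basis sA (right_ideal_of e) r p \<and>
        (\<forall>i<d. \<forall>j<r. p j * a i = (\<Sum>k<r. sA (m i j k) (p k))) \<longrightarrow>
        matrix_of (fun_scale (*)) r (dual_basis sA r p)
          (module_integral sA d a (fun_scale (*)) (dual_space sA (right_ideal_of e))
             (dual_act (right_ideal_of e))) =
        Matrix.mat r r (\<lambda>(j, k). 1 / 2 * (\<Sum>i<d. m i j k)))"
proof (intro conjI allI impI, goal_cases)
  case 1
  then show ?case using assms(2) by (intro similar_module_integrals) auto
next
  case 2
  then show ?case using assms by (intro module_integral_dsum) auto
next
  case 3
  then show ?case using assms by (intro module_integral_left_ideal) auto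
next
  case 4
  then show ?case using assms by (intro module_integral_dual_right_ideal) auto
qed

end
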